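(* Let $p$ be a prime and let $\theta\in\mathbb{F}_p((X^{-1}))$ be a counterexample to the $X$-adic Littlewood conjecture over $\mathbb{F}_p$, i.e. $$\inf_{r\geq 0,\ Q\in\mathbb{F}_p[X]\setminus\{0\}} |Q|\cdot\|X^rQ\theta\|\geq c>0$$ for some constant $c$. Then the discrepancy of the two-dimensional van der Corput--Kronecker-type sequence $\big((\varphi_p(n),\langle \theta n(X)\rangle|_p)\big)_{n\geq 0}$ satisfies $$N D_N\big((\varphi_p(n),\langle \theta n(X)\rangle|_p)\big)=\Omega(\log^2 N),$$ that is, there is a constant $c'>0$ depending only on $\theta$ and $p$ such that $N D_N\geq c'\log^2 N$ for infinitely many $N\in\mathbb{N}$.
   Context: For a field $\mathbb{F}$, $\mathbb{F}((X^{-1}))$ is the field of formal Laurent series $\theta=\sum_{i=j}^\infty a_iX^{-i}$ ($j\in\mathbb{Z}$, $a_i\in\mathbb{F}$, $a_j\neq0$). For such $\theta$: $\deg(\theta)=-j$, $|\theta|=2^{-j}$ (and $|0|=0$), the fractional part is $\langle\theta\rangle=\sum_{i\geq\max\{1,j\}}a_iX^{-i}$, and $\|\theta\|=|\langle\theta\rangle|$. For $n\in\mathbb{N}_0$ with base-$p$ expansion $n=n_0+n_1p+n_2p^2+\cdots$ ($n_i\in\{0,\dots,p-1\}$), $n(X)=n_0+n_1X+n_2X^2+\cdots\in\mathbb{F}_p[X]$, where $\mathbb{F}_p$ is identified with $\{0,1,\dots,p-1\}$. The van der Corput radical inverse is $\varphi_p(n)=\sum_{i\ge0}n_ip^{-i-1}$.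 For a Laurent series $\sum_{i\ge1}b_iX^{-i}$ over $\mathbb{F}_p$, the notation $|_p$ means substituting $X=p$ (with coefficients read as integers in $\{0,\dots,p-1\}$), giving the real number $\sum_{i\geq1}b_ip^{-i}\in[0,1)$. The discrepancy of the first $N$ points of a sequence $(\boldsymbol{x}_n)_{n\ge0}$ in $[0,1)^s$ is $D_N=\sup_J\left|\frac{\#\{0\le n<N:\boldsymbol{x}_n\in J\}}{N}-\mathrm{vol}(J)\right|$, the supremum over all boxes $J=\prod_{i=1}^s[a_i,b_i)\subseteq[0,1)^s$. *)

theory Defs
  imports "HOL-Analysis.Analysis" "HOL-Computational_Algebra.Formal_Laurent_Series"
    "HOL-Computational_Algebra.Polynomial"
begin

text \<open>Laurent series in X^-1 over a finite field 'a (of prime order p, i.e. F_p) are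
  represented as library Laurent series 'a fls in the variable Y = X^-1:
  the coefficient of X^-i is  fls_nth theta i.  Thus X itself is fls_X_inv.\<close>

definition poly_fls :: "'a::field poly \<Rightarrow> 'a fls" where
  "poly_fls Q = (\<Sum>k\<le>degree Q. fls_const (coeff Q k) * fls_X_inv ^ k)"

definition lf_abs :: "'a::field fls \<Rightarrow> real" where
  "lf_abs f = (if f = 0 then 0 else 2 powr (- real_of_int (fls_subdegree f)))"

definition lf_frac :: "'a::field fls \<Rightarrow> 'a fls" where
  "lf_frac f = Abs_fls (\<lambda>i. if i \<ge> 1 then fls_nth f i else 0)"

definition lf_dist :: "'a::field fls \<Rightarrow> real" where
  "lf_dist f = lf_abs (lf_frac f)"

definition fp_rep :: "'a::{field,finite} \<Rightarrow> nat" where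
  "fp_rep c = (THE m. m < CARD('a) \<and> (of_nat m :: 'a) = c)"

definition digit_poly_fls :: "nat \<Rightarrow> 'a::{field,finite} fls" where
  "digit_poly_fls n = (\<Sum>i\<le>n. fls_const (of_nat (n div CARD('a) ^ i mod CARD('a))) * fls_X_inv ^ i)"

definition eval_at_p :: "'a::{field,finite} fls \<Rightarrow> real" where
  "eval_at_p f = (\<Sum>i. real (fp_rep (fls_nth f (int i + 1))) / real CARD('a) ^ (i + 1))"

definition vdc :: "nat \<Rightarrow> nat \<Rightarrow> real" where
  "vdc p n = (\<Sum>i. real (n div p ^ i mod p) / real p ^ (i + 1))"

definition discrepancy2 :: "nat \<Rightarrow> (nat \<Rightarrow> real \<times> real) \<Rightarrow> real" where
  "discrepancy2 N x = (SUP J \<in> {((a1,b1),(a2,b2)) | a1 b1 a2 b2 :: real.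
        0 \<le> a1 \<and> a1 \<le> b1 \<and> b1 \<le> 1 \<and> 0 \<le> a2 \<and> a2 \<le> b2 \<and> b2 \<le> 1}.
     (case J of ((a1,b1),(a2,b2)) \<Rightarrow>
        \<bar>real (card {n. n < N \<and> x n \<in> {a1..<b1} \<times> {a2..<b2}}) / real N
          - (b1 - a1) * (b2 - a2)\<bar>))"

end

theory Submission
  imports Defs "HOL-Number_Theory.Cong"
begin

text \<open>
  Attach to every \<open>n < p^m\<close> three digit strings: the digits of \<open>n\<close> read from the top, the digits of
  \<open>n\<close> read from the bottom (the point \<open>vdc p n\<close>) and the coefficients of the fractional part of
  \<open>theta * n(X)\<close>. The hypothesis bounds the degrees of the partial quotients of all \<open>X^r * theta\<close>, so
  Hankel matrices of the coefficients of \<open>theta\<close> with \<open>t\<close> more columns than rows have full row rank.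
  Two consequences: a box prescribing \<open>s \<le> m - t\<close> digits contains exactly \<open>p^(m - s)\<close> of the \<open>n\<close>;
  and if \<open>n \<noteq> x\<close> first differ at positions \<open>r1, r2, r3\<close> of the three strings, then
  \<open>r1 + r2 + r3 < m + t\<close>, since otherwise the difference of \<open>n(X)\<close> and \<open>x(X)\<close> contradicts the hypothesis.

  Following Levin, choose \<open>x\<close> whose three strings contain, in windows of length proportional to \<open>m\<close>, the
  digit 1 at every \<open>D\<close>-th place and 0 elsewhere, and count the points in a box with upper corner
  \<open>x\<close>. This box splits into elementary boxes indexed by the place of first difference from \<open>x\<close> in each
  string. With \<open>D = 2 * t + 3\<close> every elementary box is either large enough to contain exactly its share of
  points or so small that it is empty. All errors thus have the same sign, and order \<open>m^2\<close> of the
  empty boxes have expected number of points bounded below.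
\<close>

section \<open>Digit expansions\<close>

text \<open>Most significant digit first: \<open>d 0\<close> is the digit directly after the radix point.\<close>

primrec dval :: "nat \<Rightarrow> (nat \<Rightarrow> nat) \<Rightarrow> nat \<Rightarrow> nat" where
  "dval b d 0 = 0"
| "dval b d (Suc k) = b * dval b d k + d k"

lemma mult_add_eq_iff:
  fixes b u v x y :: nat
  assumes "x < b" "y < b"
  shows "b * u + x = b * v + y \<longleftrightarrow> u = v \<and> x = y"
proof
  assume eq: "b * u + x = b * v + y"
  have "u = (b * u + x) div b" "x = (b * u + x) mod b" using assms by simp_all
  moreover have "v = (b * v + y) div b" "y = (b * v + y) mod b" using assms by simp_all
  ultimately show "u = v \<and> x = y" using eq by metis
qed simp

lemma mult_add_less_iff:
  fixes b u v x y :: nat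
  assumes "x < b" "y < b"
  shows "b * u + x < b * v + y \<longleftrightarrow> u < v \<or> u = v \<and> x < y"
proof -
  have *: "b * u' + x' < b * v' + y'" if "u' < v'" "x' < b" for u' v' x' y' :: nat
  proof -
    have "b * u' + x' < b * Suc u'" using that by simp
    also have "\<dots> \<le> b * v'" using that by (intro mult_left_mono) auto
    finally show ?thesis by simp
  qed
  show ?thesis
    using *[of u v x y] *[of v u y x] assms by (cases u v rule: linorder_cases) auto
qed

lemma dval_eq_iff:
  assumes "\<And>i. i < k \<Longrightarrow> d i < b" "\<And>i. i < k \<Longrightarrow> e i < b"
  shows "dval b d k = dval b e k \<longleftrightarrow> (\<forall>i<k. d i = e i)"
  using assms by (induction k) (auto simp: mult_add_eq_iff less_Suc_eq)

text \<open>The leading digit that differs decides, so the order is lexicographic. The witness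
  \<open>r\<close> is the place of first difference, which later indexes the elementary
  boxes.\<close>

lemma dval_less_iff:
  assumes "\<And>i. i < k \<Longrightarrow> d i < b" "\<And>i. i < k \<Longrightarrow> e i < b"
  shows "dval b d k < dval b e k \<longleftrightarrow> (\<exists>r<k. (\<forall>i<r. d i = e i) \<and> d r < e r)"
  using assms by (induction k) (auto simp: mult_add_less_iff less_Suc_eq dval_eq_iff)

lemma real_dval:
  assumes "b > 0"
  shows "real (dval b d k) / real b ^ k = (\<Sum>i<k. real (d i) / real b ^ (i + 1))"
  using assms by (induction k) (auto simp: field_simps)

lemma dval_top_digits:
  assumes "k \<le> m" "n < b ^ m"
  shows "dval b (\<lambda>i. n div b ^ (m - 1 - i) mod b) k = n div b ^ (m - k)"
  using assms(1)
proof (induction k)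
  case 0
  then show ?case using assms(2) by simp
next
  case (Suc k)
  have "m - k = Suc (m - 1 - k)" using Suc.prems by simp
  then have "n div b ^ (m - k) = n div b ^ (m - 1 - k) div b"
    by (metis div_mult2_eq mult.commute power_Suc)
  then show ?case using Suc by simp
qed

lemma digits_inj:
  fixes n n' :: nat
  assumes "n < b ^ m" "n' < b ^ m" "\<And>i. i < m \<Longrightarrow> n div b ^ i mod b = n' div b ^ i mod b"
  shows "n = n'"
proof -
  have "n = dval b (\<lambda>i. n div b ^ (m - 1 - i) mod b) m"
    using dval_top_digits[of m m n b] assms by simp
  also have "\<dots> = dval b (\<lambda>i. n' div b ^ (m - 1 - i) mod b) m"
  proof (cases "b = 0")
    case False
    then show ?thesis using assms(3) by (subst dval_eq_iff) auto
  \<comment> \<open>For base 0 the bound \<open>n < 0 ^ m\<close> forces \<open>m = 0\<close>, and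
    both strings are empty.\<close>
  qed (use assms in \<open>cases m; simp\<close>)
  also have "\<dots> = n'" using dval_top_digits[of m m n' b] assms by simp
  finally show ?thesis .
qed

lemma dval_le_expansion:
  assumes "b > 1" "\<And>i. d i < b"
  shows "real (dval b d k) / real b ^ k \<le> (\<Sum>i. real (d i) / real b ^ (i + 1))"
    and "summable (\<lambda>i. real (d i) / real b ^ (i + 1))"
proof -
  have sg: "summable (\<lambda>i. (1 / real b) ^ i)" using assms by (intro summable_geometric) auto
  show sm: "summable (\<lambda>i. real (d i) / real b ^ (i + 1))"
  proof (rule summable_comparison_test'[OF sg, of 0])
    fix i
    have "real (d i) \<le> real b" using assms(2)[of i] by simp
    then show "norm (real (d i) / real b ^ (i + 1)) \<le> (1 / real b) ^ i"
      using assms(1) by (auto simp: field_simps)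
  qed
  show "real (dval b d k) / real b ^ k \<le> (\<Sum>i. real (d i) / real b ^ (i + 1))"
    using sm assms(1) by (subst real_dval) (auto intro!: sum_le_suminf)
qed

text \<open>The digit \<open>d j\<close> excludes a tail of digits \<open>b - 1\<close>, for which equality would hold.\<close>

lemma expansion_less_dval:
  assumes b: "b > 1" and d: "\<And>i. d i < b" and j: "j \<ge> k" "d j \<noteq> b - 1"
  shows "(\<Sum>i. real (d i) / real b ^ (i + 1)) < (real (dval b d k) + 1) / real b ^ k"
proof -
  let ?f = "\<lambda>i. real (d i) / real b ^ (i + 1)"
  \<comment> \<open>\<open>?g\<close> is the expansion of 1 with all digits \<open>b - 1\<close>. It
    dominates the tail of \<open>?f\<close>, shifted by \<open>k\<close> places and rescaled, and
    strictly so at index \<open>j - k\<close>.\<close>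
  let ?g = "\<lambda>i. (real b - 1) / real b * (1 / real b) ^ i"
  have sm: "summable ?f" using dval_le_expansion(2)[OF b d] .
  have g: "?g sums ((real b - 1) / real b * (1 / (1 - 1 / real b)))"
    using b by (intro sums_mult geometric_sums) auto
  have "real b - 1 \<noteq> 0" using b by simp
  then have "(real b - 1) / real b * (1 / (1 - 1 / real b)) = 1" using b by (simp add: field_simps)
  with g have g1: "?g sums 1" by metis
  have smk: "summable (\<lambda>i. ?f (i + k) * real b ^ k)"
    using summable_ignore_initial_segment[OF sm] by (intro summable_mult2)
  have le: "?f (i + k) * real b ^ k \<le> ?g i" for i
  proof -
    have "real (d (i + k)) \<le> real b - 1" using d[of "i + k"] by linarith
    then have "real (d (i + k)) / real b ^ (i + 1) \<le> (real b - 1) / real b ^ (i + 1)"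
      using b by (intro divide_right_mono) auto
    then show ?thesis using b by (simp add: field_simps power_add)
  qed
  have lt: "?f (j - k + k) * real b ^ k < ?g (j - k)"
  proof -
    have "real (d (j - k + k)) < real b - 1" using d[of j] j by simp
    then have "real (d (j - k + k)) / real b ^ (j - k + 1) < (real b - 1) / real b ^ (j - k + 1)"
      using b by (intro divide_strict_right_mono) auto
    moreover have "?f (j - k + k) * real b ^ k = real (d (j - k + k)) / real b ^ (j - k + 1)"
      using b by (simp add: power_add)
    moreover have "?g (j - k) = (real b - 1) / real b ^ (j - k + 1)"
      by (simp add: power_one_over)
    ultimately show ?thesis by simp
  qed
  have "0 < (\<Sum>i. ?g i - ?f (i + k) * real b ^ k)"
    using le lt by (intro suminf_pos2[where i = "j - k"] summable_diff smk sums_summable[OF g1]) 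
      (auto simp: le_diff_eq less_diff_eq)
  also have "\<dots> = 1 - (\<Sum>i. ?f (i + k) * real b ^ k)"
    using smk g1 by (subst suminf_diff[symmetric]) (auto simp: sums_iff)
  also have "(\<Sum>i. ?f (i + k) * real b ^ k) = (\<Sum>i. ?f (i + k)) * real b ^ k"
    using summable_ignore_initial_segment[OF sm] by (rule suminf_mult2[symmetric])
  finally have "(\<Sum>i. ?f (i + k)) < 1 / real b ^ k" using b by (simp add: field_simps)
  moreover have "(\<Sum>i. ?f i) = (\<Sum>i. ?f (i + k)) + (\<Sum>i<k. ?f i)"
    using suminf_split_initial_segment[OF sm] .
  moreover have "(\<Sum>i<k. ?f i) = real (dval b d k) / real b ^ k"
    using real_dval[where b = b and d = d and k = k] b by simp
  ultimately show ?thesis by (simp add: add_divide_distrib)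
qed

text \<open>The value of the expansion lies in the half-open interval of length
  \<open>1 / b ^ k\<close> that starts at its truncation to \<open>k\<close> digits, so a threshold
  on the grid of step \<open>1 / b ^ k\<close> only sees these digits.\<close>

lemma expansion_less_dval_iff:
  assumes b: "b > 1" and d: "\<And>i. d i < b" and j: "j \<ge> k" "d j \<noteq> b - 1"
  shows "(\<Sum>i. real (d i) / real b ^ (i + 1)) < real v / real b ^ k \<longleftrightarrow> dval b d k < v"
proof
  assume "(\<Sum>i. real (d i) / real b ^ (i + 1)) < real v / real b ^ k"
  then have "real (dval b d k) / real b ^ k < real v / real b ^ k"
    using dval_le_expansion(1)[where b = b and d = d and k = k, OF b d] by linarith
  then show "dval b d k < v" using b by (simp add: divide_strict_right_mono divide_less_cancel)
next
  assume "dval b d k < v"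
  then have "real (dval b d k) + 1 \<le> real v" by linarith
  then have "(real (dval b d k) + 1) / real b ^ k \<le> real v / real b ^ k"
    using b by (intro divide_right_mono) auto
  then show "(\<Sum>i. real (d i) / real b ^ (i + 1)) < real v / real b ^ k"
    using expansion_less_dval[where d = d and k = k, OF assms] by linarith
qed

section \<open>Linear systems and prime fields\<close>

text \<open>Gaussian elimination, one row at a time: independent rows cut the number of solutions by
  a factor \<open>CARD('a)\<close> each, whatever the right-hand side. The product form avoids
  truncated subtraction in the exponent.\<close>

lemma card_linear_system:
  fixes a :: "'j \<Rightarrow> 'k \<Rightarrow> 'a::{field,finite}"
  assumes "finite J" "finite K"
    and "\<And>c. (\<forall>k\<in>K. (\<Sum>j\<in>J. c j * a j k) = 0) \<Longrightarrow> \<forall>j\<in>J. c j = 0"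
  shows "card {q \<in> K \<rightarrow>\<^sub>E UNIV. \<forall>j\<in>J. (\<Sum>k\<in>K. a j k * q k) = b j} * CARD('a) ^ card J
    = CARD('a) ^ card K"
  using assms
proof (induction J arbitrary: K a b rule: finite_induct)
  case empty
  then show ?case by (simp add: card_PiE)
next
  case (insert l J)
  have fK: "finite K" by fact
  have "\<exists>k0\<in>K. a l k0 \<noteq> 0"
  proof (rule ccontr)
    assume "\<not> ?thesis"
    \<comment> \<open>A zero row would be a relation by itself, with the unit vector at
      \<open>l\<close> as its coefficients.\<close>
    then have "\<forall>k\<in>K. (\<Sum>j\<in>insert l J. (if j = l then 1 else 0) * a j k) = 0"
      using insert.hyps by (auto intro!: sum.neutral)
    from insert.prems(2)[OF this] show False by auto
  qed
  then obtain k0 where k0: "k0 \<in> K" "a l k0 \<noteq> 0" by blast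
  \<comment> \<open>Elimination with pivot \<open>a l k0\<close>: subtracting \<open>e j\<close>
    times row \<open>l\<close> clears column \<open>k0\<close> and leaves a system in the unknowns
    \<open>K'\<close>.\<close>
  define K' where "K' = K - {k0}"
  define e where "e j = a j k0 / a l k0" for j
  define a' where "a' j k = a j k - e j * a l k" for j k
  define b' where "b' j = b j - e j * b l" for j
  have K: "K = insert k0 K'" "k0 \<notin> K'" "finite K'" using k0 fK by (auto simp: K'_def)
  have a'0: "a' j k0 = 0" for j using k0 by (simp add: a'_def e_def)
  have ak0: "a j k0 = e j * a l k0" for j using k0 by (simp add: e_def)
  have sys: "(\<Sum>k\<in>K. a j k * q k) - e j * (\<Sum>k\<in>K. a l k * q k) = (\<Sum>k\<in>K'. a' j k * q k)"
    for j q
  proof -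
    have "(\<Sum>k\<in>K. a j k * q k) - e j * (\<Sum>k\<in>K. a l k * q k) = (\<Sum>k\<in>K. a' j k * q k)"
      by (simp add: a'_def sum_distrib_left sum_subtractf algebra_simps)
    then show ?thesis using K a'0 by simp
  qed
  let ?S = "{q \<in> K \<rightarrow>\<^sub>E UNIV. \<forall>j\<in>insert l J. (\<Sum>k\<in>K. a j k * q k) = b j}"
  let ?S' = "{q \<in> K' \<rightarrow>\<^sub>E UNIV. \<forall>j\<in>J. (\<Sum>k\<in>K'. a' j k * q k) = b' j}"
  have IH: "card ?S' * CARD('a) ^ card J = CARD('a) ^ card K'"
  proof (rule insert.IH[OF K(3)])
    fix c assume c: "\<forall>k\<in>K'. (\<Sum>j\<in>J. c j * a' j k) = 0"
    \<comment> \<open>A relation among the reduced rows becomes one among the original rows when the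
      coefficient of row \<open>l\<close> collects the subtracted multiples.\<close>
    define c2 where "c2 = c(l := - (\<Sum>j\<in>J. c j * e j))"
    have "(\<Sum>j\<in>insert l J. c2 j * a j k) = 0" if "k \<in> K" for k
    proof -
      have "(\<Sum>j\<in>insert l J. c2 j * a j k) = c2 l * a l k + (\<Sum>j\<in>J. c j * a j k)"
        using insert.hyps by (auto simp: c2_def intro!: sum.cong)
      also have "\<dots> = (\<Sum>j\<in>J. c j * a' j k)"
        by (simp add: c2_def a'_def sum_distrib_left sum_distrib_right sum_subtractf algebra_simps)
      also have "\<dots> = 0" using c that K a'0 by (cases "k = k0") auto
      finally show ?thesis .
    qed
    with insert.prems(2)[of c2] have "\<forall>j\<in>insert l J. c2 j = 0" by blast
    then show "\<forall>j\<in>J. c j = 0" using insert.hyps unfolding c2_def by (metis fun_upd_other insertCI)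
  qed
  \<comment> \<open>The inverse of restriction to \<open>K'\<close>: equation \<open>l\<close>
    determines the pivot unknown from the others.\<close>
  define ext where
    "ext q = (\<lambda>k. if k = k0 then (b l - (\<Sum>k\<in>K'. a l k * q k)) / a l k0 else q k)" for q
  have ext_l: "(\<Sum>k\<in>K. a l k * ext q k) = b l" for q
  proof -
    have "(\<Sum>k\<in>K'. a l k * ext q k) = (\<Sum>k\<in>K'. a l k * q k)"
      using K by (intro sum.cong) (auto simp: ext_def)
    then show ?thesis using K k0 by (simp add: ext_def)
  qed
  have ext_a': "(\<Sum>k\<in>K'. a' j k * ext q k) = (\<Sum>k\<in>K'. a' j k * q k)" for j q
    using K by (intro sum.cong) (auto simp: ext_def)
  have "bij_betw (\<lambda>q. restrict q K') ?S ?S'"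
  proof (rule bij_betwI[where g = ext])
    show "(\<lambda>q. restrict q K') \<in> ?S \<rightarrow> ?S'"
    proof
      fix q assume q: "q \<in> ?S"
      have "(\<Sum>k\<in>K'. a' j k * restrict q K' k) = b' j" if "j \<in> J" for j
      proof -
        have "(\<Sum>k\<in>K'. a' j k * restrict q K' k) = (\<Sum>k\<in>K'. a' j k * q k)" by (intro sum.cong) auto
        then show ?thesis using sys[of j q] q that by (simp add: b'_def)
      qed
      then show "restrict q K' \<in> ?S'" by auto
    qed
    show "ext \<in> ?S' \<rightarrow> ?S"
    proof
      fix q assume q: "q \<in> ?S'"
      have "(\<Sum>k\<in>K. a j k * ext q k) = b j" if "j \<in> insert l J" for j
      proof (cases "j = l")
        case False
        then have "(\<Sum>k\<in>K'. a' j k * q k) = b' j" using q that by auto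
        then show ?thesis using sys[of j "ext q"] ext_l[of q] ext_a'[of j q] by (simp add: b'_def)
      qed (use ext_l in simp)
      moreover have "ext q \<in> K \<rightarrow>\<^sub>E UNIV" using q K by (auto simp: ext_def PiE_def extensional_def)
      ultimately show "ext q \<in> ?S" by blast
    qed
    fix q assume q: "q \<in> ?S"
    show "ext (restrict q K') = q"
    proof
      fix k
      have "(\<Sum>k\<in>K'. a l k * restrict q K' k) = (\<Sum>k\<in>K'. a l k * q k)" by (intro sum.cong) auto
      moreover have "(\<Sum>k\<in>K. a l k * q k) = b l" using q by auto
      then have "a l k0 * q k0 = b l - (\<Sum>k\<in>K'. a l k * q k)" using K by (simp add: algebra_simps)
      ultimately show "ext (restrict q K') k = q k"
        using K k0 q by (auto simp: ext_def PiE_def extensional_def field_simps)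
    qed
  next
    fix q assume q: "q \<in> ?S'"
    then show "restrict (ext q) K' = q" 
      using K by (auto simp: ext_def PiE_def extensional_def fun_eq_iff)
  qed
  then have "card ?S = card ?S'" by (rule bij_betw_same_card)
  moreover have "card (insert l J) = Suc (card J)" "card K = Suc (card K')" using insert.hyps K by auto
  ultimately show ?case using IH by simp
qed

section \<open>Prime fields and their digit vectors\<close>

lemma CHAR_eq_CARD:
  assumes "prime (CARD('a::{field,finite}))"
  shows "CHAR('a) = CARD('a)"
proof -
  \<comment> \<open>Translation by 1 permutes the field, so the sum of all elements absorbs
    \<open>CARD('a)\<close> copies of 1; hence the characteristic divides the prime
    \<open>CARD('a)\<close>.\<close>
  have "(\<Sum>x\<in>UNIV. x :: 'a) = (\<Sum>x\<in>UNIV. x + 1)"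
    by (rule sum.reindex_bij_witness[of _ "\<lambda>x. x + 1" "\<lambda>x. x - 1"]) auto
  then have "(of_nat (CARD('a)) :: 'a) = 0" by (simp add: sum.distrib)
  then have "CHAR('a) dvd CARD('a)" by (simp add: of_nat_eq_0_iff_char_dvd)
  then show ?thesis using assms CHAR_not_1[where 'a='a] by (metis One_nat_def prime_nat_iff)
qed

lemma of_nat_CARD_eq_iff:
  assumes "prime (CARD('a::{field,finite}))" "m < CARD('a)" "n < CARD('a)"
  shows "(of_nat m :: 'a) = of_nat n \<longleftrightarrow> m = n"
  using assms by (simp add: of_nat_eq_iff_cong_CHAR CHAR_eq_CARD cong_def)

lemma bij_of_nat_CARD:
  assumes "prime (CARD('a::{field,finite}))"
  shows "bij_betw (of_nat :: nat \<Rightarrow> 'a) {..<CARD('a)} UNIV"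
proof -
  have inj: "inj_on (of_nat :: nat \<Rightarrow> 'a) {..<CARD('a)}"
    using assms by (auto simp: inj_on_def of_nat_CARD_eq_iff)
  then have "of_nat ` {..<CARD('a)} = (UNIV :: 'a set)"
    by (intro card_subset_eq) (auto simp: card_image)
  with inj show ?thesis by (simp add: bij_betw_def)
qed

text \<open>Residues below a prime \<open>CARD('a)\<close> hit every field element exactly once,
  which makes the definite description in \<open>fp_rep\<close> meaningful.\<close>

lemma fp_rep:
  assumes "prime (CARD('a::{field,finite}))"
  shows "fp_rep (c::'a) < CARD('a)" and "of_nat (fp_rep c) = c"
proof -
  have "\<exists>!m. m < CARD('a) \<and> (of_nat m :: 'a) = c"
  proof (rule ex_ex1I)
    have "c \<in> of_nat ` {..<CARD('a)}"
      using bij_of_nat_CARD[OF assms] by (simp add: bij_betw_def)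
    then show "\<exists>m. m < CARD('a) \<and> (of_nat m :: 'a) = c" by auto
  qed (use of_nat_CARD_eq_iff[OF assms] in blast)
  from theI'[OF this] show "fp_rep c < CARD('a)" "of_nat (fp_rep c) = c"
    unfolding fp_rep_def by auto
qed

lemma fp_rep_of_nat:
  assumes "prime (CARD('a::{field,finite}))" "m < CARD('a)"
  shows "fp_rep (of_nat m :: 'a) = m"
  using fp_rep[OF assms(1)] of_nat_CARD_eq_iff[OF assms(1)] assms(2) by blast

lemma fp_rep_eq_iff:
  assumes "prime (CARD('a::{field,finite}))"
  shows "fp_rep (c::'a) = fp_rep c' \<longleftrightarrow> c = c'"
  using fp_rep[OF assms] by metis

text \<open>These are the coefficients of the polynomial \<open>n(X)\<close>.\<close>

definition dig :: "nat \<Rightarrow> nat \<Rightarrow> 'a::{field,finite}" where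
  "dig n i = of_nat (n div CARD('a) ^ i mod CARD('a))"

lemma dig_eq_iff:
  assumes "prime (CARD('a::{field,finite}))"
  shows "(dig n i :: 'a) = dig n' i' \<longleftrightarrow>
    n div CARD('a) ^ i mod CARD('a) = n' div CARD('a) ^ i' mod CARD('a)"
  unfolding dig_def by (intro of_nat_CARD_eq_iff assms) auto

text \<open>This turns counting integers below \<open>CARD('a) ^ m\<close> into counting vectors, to
  which \<open>card_linear_system\<close> applies.\<close>

lemma bij_digits:
  assumes "prime (CARD('a::{field,finite}))"
  shows "bij_betw (\<lambda>n. \<lambda>i\<in>{..<m}. dig n i :: 'a) {..<CARD('a) ^ m} ({..<m} \<rightarrow>\<^sub>E UNIV)"
proof -
  let ?f = "\<lambda>n. \<lambda>i\<in>{..<m}. dig n i :: 'a"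
  have inj: "inj_on ?f {..<CARD('a) ^ m}"
  proof (rule inj_onI)
    fix n n' assume *: "n \<in> {..<CARD('a) ^ m}" "n' \<in> {..<CARD('a) ^ m}" "?f n = ?f n'"
    show "n = n'"
    proof (rule digits_inj)
      fix i assume "i < m"
      then have "(dig n i :: 'a) = dig n' i" using fun_cong[OF *(3), of i] by simp
      then show "n div CARD('a) ^ i mod CARD('a) = n' div CARD('a) ^ i mod CARD('a)"
        by (simp add: dig_eq_iff[OF assms])
    qed (use * in auto)
  qed
  moreover have "?f ` {..<CARD('a) ^ m} = ({..<m} \<rightarrow>\<^sub>E UNIV)"
    using inj by (intro card_subset_eq finite_PiE) (auto simp: card_image card_PiE intro!: restrict_PiE_iff[THEN iffD2])
  ultimately show ?thesis by (simp add: bij_betw_def)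
qed

section \<open>Counterexamples and their Hankel matrices\<close>

lemma lf_frac_nth: "fls_nth (lf_frac f) i = (if i \<ge> 1 then fls_nth f i else 0)"
  unfolding lf_frac_def by (subst nth_Abs_fls) auto

lemma fls_X_inv_power_times_nth: "fls_nth (fls_X_inv ^ k * f) n = fls_nth f (n + int k)"
  by (simp add: fls_X_inv_power_times_conv_shift)

lemma fls_const_X_inv_power_times_nth:
  "fls_nth (fls_const c * fls_X_inv ^ k * f) n = c * fls_nth f (n + int k)"
  by (simp add: mult.assoc fls_X_inv_power_times_nth)

lemma poly_fls_times_nth:
  assumes "degree Q < L"
  shows "fls_nth (poly_fls Q * f) n = (\<Sum>k<L. coeff Q k * fls_nth f (n + int k))"
proof -
  have "fls_nth (poly_fls Q * f) n = (\<Sum>k\<le>degree Q. coeff Q k * fls_nth f (n + int k))"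
    unfolding poly_fls_def sum_distrib_right fls_nth_sum
    by (simp only: fls_const_X_inv_power_times_nth)
  also have "\<dots> = (\<Sum>k<L. coeff Q k * fls_nth f (n + int k))"
    using assms by (intro sum.mono_neutral_left) (auto simp: coeff_eq_0)
  finally show ?thesis .
qed

lemma lf_abs_le:
  assumes "\<And>k. k < d \<Longrightarrow> fls_nth f k = 0"
  shows "lf_abs f \<le> 2 powr (- real_of_int d)"
  using fls_subdegree_geI[of f d] assms by (auto simp: lf_abs_def)

lemma lf_abs_poly_fls_le:
  assumes "degree Q < L"
  shows "lf_abs (poly_fls Q) \<le> 2 powr real L"
proof -
  have "lf_abs (poly_fls Q) \<le> 2 powr (- real_of_int (- int L))"
  proof (rule lf_abs_le)
    fix k assume "k < - int L"
    \<comment> \<open>The coefficient formula is applied with the series 1 as second factor.\<close>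
    then show "fls_nth (poly_fls Q) k = 0"
      using poly_fls_times_nth[OF assms, of 1 k] by (auto intro!: sum.neutral)
  qed
  then show ?thesis by simp
qed

text \<open>By \<open>nonvanishing\<close>, the columns of an \<open>M\<close> by \<open>L\<close>
  Hankel block of coefficients are independent as soon as \<open>M\<close> exceeds \<open>L\<close>
  by \<open>t\<close>. The margin \<open>t\<close> does not depend on the offset \<open>s\<close>,
  which stands for the factor \<open>X^s\<close>.\<close>

locale badly_approximable =
  fixes theta :: "'a::{field,finite} fls" and t :: nat
  assumes prime_CARD: "prime (CARD('a))"
    and nonvanishing: "\<And>s L M c j. j < L \<Longrightarrow> c j \<noteq> 0 \<Longrightarrow> L + t \<le> M \<Longrightarrow>
      \<exists>i<M. (\<Sum>j<L. c j * fls_nth theta (int (s + i + j + 1))) \<noteq> 0"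

text \<open>A nonzero kernel vector is the coefficient vector of some \<open>Q\<close> with
  \<open>|Q|\<close> at most \<open>2^L\<close>, and the first \<open>M\<close> fractional
  coefficients of \<open>X^s Q theta\<close> vanish. The product in the hypothesis is then at most
  \<open>2^(L - M - 1)\<close>, hence at most \<open>2^(-t)\<close>, and \<open>t\<close> is chosen
  to make this smaller than \<open>C\<close>.\<close>

lemma badly_approximable_if_counterexample:
  fixes theta :: "'a::{field,finite} fls"
  assumes "prime (CARD('a))"
    and c: "C > 0" "\<And>r Q. Q \<noteq> 0 \<Longrightarrow> C \<le> lf_abs (poly_fls Q) * lf_dist (fls_X_inv ^ r * poly_fls Q * theta)"
  shows "\<exists>t. badly_approximable theta t"
proof -
  obtain t where t: "(1 / 2) ^ t < C" using c(1) real_arch_pow_inv[of C "1/2"] by auto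
  have "badly_approximable theta t"
  proof
    fix s L M j and c :: "nat \<Rightarrow> 'a"
    assume j: "j < L" "c j \<noteq> 0" and LM: "L + t \<le> M"
    show "\<exists>i<M. (\<Sum>j<L. c j * fls_nth theta (int (s + i + j + 1))) \<noteq> 0"
    proof (rule ccontr)
      assume "\<not> ?thesis"
      then have zero: "(\<Sum>j<L. c j * fls_nth theta (int (s + i + j + 1))) = 0" if "i < M" for i
        using that by blast
      define Q where "Q = (\<Sum>j<L. monom (c j) j)"
      have coeff_Q: "coeff Q k = (if k < L then c k else 0)" for k
        by (auto simp: Q_def coeff_sum)
      have "Q \<noteq> 0" using j coeff_Q[of j] by auto
      moreover have "degree Q < L"
      proof -
        have "coeff Q (degree Q) \<noteq> 0" using \<open>Q \<noteq> 0\<close> by simp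
        then show ?thesis using coeff_Q[of "degree Q"] by (auto split: if_splits)
      qed
      ultimately have Q: "Q \<noteq> 0" "degree Q < L" by auto
      have "lf_dist (fls_X_inv ^ s * poly_fls Q * theta) \<le> 2 powr (- real_of_int (int (M + 1)))"
        unfolding lf_dist_def
      proof (rule lf_abs_le)
        fix k assume k: "k < int (M + 1)"
        show "fls_nth (lf_frac (fls_X_inv ^ s * poly_fls Q * theta)) k = 0"
        proof (cases "k \<ge> 1")
          case True
          define i where "i = nat (k - 1)"
          have i: "i < M" "k = int i + 1" using True k by (auto simp: i_def)
          have "fls_nth (fls_X_inv ^ s * poly_fls Q * theta) k
              = (\<Sum>j<L. coeff Q j * fls_nth theta (k + int s + int j))"
            by (simp add: mult.assoc fls_X_inv_power_times_nth poly_fls_times_nth[OF Q(2)])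
          also have "\<dots> = (\<Sum>j<L. c j * fls_nth theta (int (s + i + j + 1)))"
            by (intro sum.cong) (auto simp: coeff_Q i algebra_simps)
          finally show ?thesis using zero[OF i(1)] by (simp add: lf_frac_nth)
        qed (simp add: lf_frac_nth)
      qed
      then have "lf_abs (poly_fls Q) * lf_dist (fls_X_inv ^ s * poly_fls Q * theta)
          \<le> 2 powr real L * 2 powr (- real (M + 1))"
        using lf_abs_poly_fls_le[OF Q(2)] by (intro mult_mono) (auto simp: lf_dist_def lf_abs_def)
      also have "\<dots> = 2 powr (real L + - real (M + 1))" by (rule powr_add [symmetric])
      also have "\<dots> \<le> 2 powr (- real t)" using LM by (intro powr_mono) auto
      also have "\<dots> = (1 / 2) ^ t" by (simp add: powr_minus powr_realpow power_one_over inverse_eq_divide)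
      finally show False using c(2)[OF Q(1), of s] t by linarith
    qed
  qed fact
  then show ?thesis ..
qed

section \<open>Fractional digits as linear forms, exact counts and agreement\<close>

context badly_approximable
begin

definition fdig :: "nat \<Rightarrow> nat \<Rightarrow> 'a" where
  "fdig n j = fls_nth (lf_frac (theta * digit_poly_fls n)) (int j + 1)"

lemma CARD_gt_1: "CARD('a) > 1"
  using prime_CARD prime_gt_1_nat by blast

text \<open>The digits of the second coordinate are linear forms in the digits of \<open>n\<close>,
  and their coefficients form a Hankel matrix.\<close>

lemma fdig_eq:
  assumes "n < CARD('a) ^ m"
  shows "fdig n j = (\<Sum>i<m. fls_nth theta (int (j + i + 1)) * dig n i)"
proof -
  let ?f = "\<lambda>i. fls_nth theta (int (j + i + 1)) * dig n i"
  have dig0: "(dig n i :: 'a) = 0" if "n < CARD('a) ^ i" for i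
    using that by (simp add: dig_def)
  have "fdig n j = fls_nth (digit_poly_fls n * theta) (int j + 1)"
    by (simp add: fdig_def lf_frac_nth mult.commute)
  also have "\<dots> = (\<Sum>i\<le>n. ?f i)"
    unfolding digit_poly_fls_def sum_distrib_right fls_nth_sum
    by (simp only: fls_const_X_inv_power_times_nth) (simp add: dig_def algebra_simps)
  \<comment> \<open>Either of the two ranges can be the longer one, so the sum passes through their
    union; the extra terms have digit 0.\<close>
  also have "\<dots> = (\<Sum>i\<in>{..n} \<union> {..<m}. ?f i)"
  proof (rule sum.mono_neutral_left)
    show "\<forall>i\<in>{..n} \<union> {..<m} - {..n}. ?f i = 0"
    proof
      fix i assume "i \<in> {..n} \<union> {..<m} - {..n}"
      then have "n < i" by auto
      also have "i < 2 ^ i" by (rule less_exp)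
      also have "(2::nat) ^ i \<le> CARD('a) ^ i" using CARD_gt_1 by (intro power_mono) auto
      finally show "?f i = 0" using dig0 by simp
    qed
  qed auto
  also have "\<dots> = (\<Sum>i<m. ?f i)"
  proof (rule sum.mono_neutral_right)
    show "\<forall>i\<in>{..n} \<union> {..<m} - {..<m}. ?f i = 0"
    proof
      fix i assume "i \<in> {..n} \<union> {..<m} - {..<m}"
      then have "m \<le> i" by auto
      then have "CARD('a) ^ m \<le> CARD('a) ^ i" using CARD_gt_1 by (intro power_increasing) auto
      then show "?f i = 0" using dig0[of i] assms by simp
    qed
  qed auto
  finally show ?thesis .
qed

text \<open>Hankel entries depend only on the sum of the indices, so rows and columns may be
  exchanged and \<open>nonvanishing\<close> applies with offset \<open>j0 + r\<close> and
  \<open>M = e - r\<close>.\<close>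

lemma hankel_rows_independent:
  assumes "\<forall>k\<in>{r..<e}. (\<Sum>j\<in>{j0..<j0 + L}. c j * fls_nth theta (int (j + k + 1))) = 0"
    and "r + L + t \<le> e"
  shows "\<forall>j\<in>{j0..<j0 + L}. c j = 0"
proof (rule ccontr)
  assume "\<not> ?thesis"
  then obtain j where j: "j \<in> {j0..<j0 + L}" "c j \<noteq> 0" by blast
  have "\<exists>i<e - r. (\<Sum>j<L. c (j0 + j) * fls_nth theta (int ((j0 + r) + i + j + 1))) \<noteq> 0"
    using j assms(2) by (intro nonvanishing[of "j - j0" L "\<lambda>j. c (j0 + j)"]) auto
  then obtain i where i: "i < e - r"
    "(\<Sum>j<L. c (j0 + j) * fls_nth theta (int ((j0 + r) + i + j + 1))) \<noteq> 0" by blast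
  have "(\<Sum>j<L. c (j0 + j) * fls_nth theta (int ((j0 + r) + i + j + 1)))
      = (\<Sum>j\<in>{j0..<j0 + L}. c j * fls_nth theta (int (j + (r + i) + 1)))"
    by (rule sum.reindex_bij_witness[of _ "\<lambda>j. j - j0" "\<lambda>j. j0 + j"]) (auto simp: algebra_simps)
  also have "\<dots> = 0" using assms(1)[rule_format, of "r + i"] i(1) by simp
  finally show False using i(2) by simp
qed

text \<open>Prescribed coordinates are unit rows, prescribed fractional digits are Hankel rows. In a
  linear relation the columns from \<open>r\<close> to \<open>e - 1\<close> meet Hankel rows only,
  so those coefficients vanish first; each unit row is then read off in its own column.\<close>

lemma card_digit_vectors:
  fixes g b :: "nat \<Rightarrow> 'a"
  assumes e: "e \<le> m" "r + L + t \<le> e"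
  shows "card {q \<in> {..<m} \<rightarrow>\<^sub>E UNIV. (\<forall>i<r. q i = g i) \<and> (\<forall>i\<in>{e..<m}. q i = g i) \<and>
      (\<forall>j\<in>{j0..<j0 + L}. (\<Sum>i<m. fls_nth theta (int (j + i + 1)) * q i) = b j)}
    * CARD('a) ^ (r + (m - e) + L) = CARD('a) ^ m"
proof -
  define E where "E = {..<r} \<union> {e..<m}"
  let ?R = "{j0..<j0 + L}"
  \<comment> \<open>\<open>Inl\<close> indexes the unit rows, \<open>Inr\<close> the Hankel
    rows.\<close>
  let ?a = "case_sum (\<lambda>i k. if k = i then 1 else 0) (\<lambda>j k. fls_nth theta (int (j + k + 1)))"
  let ?S = "{q \<in> {..<m} \<rightarrow>\<^sub>E UNIV. \<forall>j\<in>E <+> ?R. (\<Sum>k\<in>{..<m}. ?a j k * q k) = case_sum g b j}"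
  have fin: "finite E" and E: "E \<subseteq> {..<m}" using e by (auto simp: E_def)
  have cardE: "card E = r + (m - e)" unfolding E_def using e by (subst card_Un_disjoint) auto
  have "card ?S * CARD('a) ^ card (E <+> ?R) = CARD('a) ^ card {..<m}"
  proof (rule card_linear_system)
    fix c :: "nat + nat \<Rightarrow> 'a"
    assume "\<forall>k\<in>{..<m}. (\<Sum>j\<in>E <+> ?R. c j * ?a j k) = 0"
    then have c: "(\<Sum>i\<in>E. c (Inl i) * (if k = i then 1 else 0))
        + (\<Sum>j\<in>?R. c (Inr j) * fls_nth theta (int (j + k + 1))) = 0" if "k < m" for k
      using that fin by (simp add: sum.Plus)
    have "\<forall>k\<in>{r..<e}. (\<Sum>j\<in>?R. c (Inr j) * fls_nth theta (int (j + k + 1))) = 0"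
    proof
      fix k assume k: "k \<in> {r..<e}"
      then have "(\<Sum>i\<in>E. c (Inl i) * (if k = i then 1 else 0)) = 0"
        by (intro sum.neutral) (auto simp: E_def)
      then show "(\<Sum>j\<in>?R. c (Inr j) * fls_nth theta (int (j + k + 1))) = 0"
        using c[of k] k e by auto
    qed
    then have R: "\<forall>j\<in>?R. c (Inr j) = 0" by (rule hankel_rows_independent) (use e in auto)
    have "c (Inl k) = 0" if "k \<in> E" for k
    proof -
      have "(\<Sum>j\<in>?R. c (Inr j) * fls_nth theta (int (j + k + 1))) = 0"
        using R by (intro sum.neutral) auto
      moreover have "(\<Sum>i\<in>E. c (Inl i) * (if k = i then 1 else 0)) = c (Inl k)"
        using that fin by (simp add: if_distrib sum.delta cong: if_cong)
      ultimately show ?thesis using c[of k] that E by auto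
    qed
    with R show "\<forall>j\<in>E <+> ?R. c j = 0" by auto
  qed (use fin in auto)
  moreover have "card (E <+> ?R) = r + (m - e) + L"
    using fin cardE by (simp add: card_Plus)
  moreover have "?S = {q \<in> {..<m} \<rightarrow>\<^sub>E UNIV. (\<forall>i<r. q i = g i) \<and> (\<forall>i\<in>{e..<m}. q i = g i) \<and>
      (\<forall>j\<in>{j0..<j0 + L}. (\<Sum>i<m. fls_nth theta (int (j + i + 1)) * q i) = b j)}"
  proof -
    have "(\<Sum>k\<in>{..<m}. (if k = i then 1 else 0) * q k) = q i" if "i \<in> E" for i and q :: "nat \<Rightarrow> 'a"
      using that E by (auto simp: if_distrib[of "\<lambda>x. x * _"] cong: if_cong)
    then have "(\<forall>j\<in>E <+> ?R. (\<Sum>k\<in>{..<m}. ?a j k * q k) = case_sum g b j) \<longleftrightarrow>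
        (\<forall>i\<in>E. q i = g i) \<and> (\<forall>j\<in>?R. (\<Sum>i<m. fls_nth theta (int (j + i + 1)) * q i) = b j)" for q
      by (auto simp: ball_Un Plus_def)
    moreover have "(\<forall>i\<in>E. q i = g i) \<longleftrightarrow> (\<forall>i<r. q i = g i) \<and> (\<forall>i\<in>{e..<m}. q i = g i)" for q
      by (auto simp: E_def)
    ultimately show ?thesis by auto
  qed
  ultimately show ?thesis by simp
qed

text \<open>The count of vectors is transported along the digit bijection. The free block of digits
  from \<open>r\<close> to \<open>e - 1\<close> has to exceed the number \<open>L\<close> of
  fractional conditions by \<open>t\<close>.\<close>

lemma card_elementary_box:
  fixes g b :: "nat \<Rightarrow> 'a"
  assumes e: "e \<le> m" "r + L + t \<le> e"
  shows "card {n. n < CARD('a) ^ m \<and> (\<forall>i<r. dig n i = g i) \<and> (\<forall>i\<in>{e..<m}. dig n i = g i) \<and>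
      (\<forall>j\<in>{j0..<j0 + L}. fdig n j = b j)} * CARD('a) ^ (r + (m - e) + L) = CARD('a) ^ m"
    (is "card ?N * _ = _")
proof -
  define f where "f n = (\<lambda>i\<in>{..<m}. dig n i :: 'a)" for n
  define N where "N = ?N"
  define S where "S = {q \<in> {..<m} \<rightarrow>\<^sub>E UNIV. (\<forall>i<r. q i = g i) \<and> (\<forall>i\<in>{e..<m}. q i = g i) \<and>
      (\<forall>j\<in>{j0..<j0 + L}. (\<Sum>i<m. fls_nth theta (int (j + i + 1)) * q i) = b j)}"
  have bij: "bij_betw f {..<CARD('a) ^ m} ({..<m} \<rightarrow>\<^sub>E UNIV)"
    using bij_digits[OF prime_CARD, of m] by (simp add: f_def[abs_def])
  have iff: "f n \<in> S \<longleftrightarrow> n \<in> N" if "n < CARD('a) ^ m" for n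
  proof -
    have "(\<Sum>i<m. fls_nth theta (int (j + i + 1)) * f n i) = fdig n j" for j
      unfolding fdig_eq[OF that] by (intro sum.cong) (auto simp: f_def)
    moreover have "(\<forall>i<r. f n i = g i) \<longleftrightarrow> (\<forall>i<r. dig n i = g i)" using e by (auto simp: f_def)
    moreover have "(\<forall>i\<in>{e..<m}. f n i = g i) \<longleftrightarrow> (\<forall>i\<in>{e..<m}. dig n i = g i)" by (auto simp: f_def)
    moreover have "f n \<in> {..<m} \<rightarrow>\<^sub>E UNIV" by (auto simp: f_def)
    ultimately show ?thesis using that by (auto simp: S_def N_def)
  qed
  have "f ` N = S"
  proof
    show "f ` N \<subseteq> S" using iff by (auto simp: N_def)
    show "S \<subseteq> f ` N"
    proof
      fix q assume q: "q \<in> S"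
      then have "q \<in> f ` {..<CARD('a) ^ m}" using bij by (simp add: bij_betw_def S_def)
      then obtain n where "n < CARD('a) ^ m" "q = f n" by auto
      with q iff show "q \<in> f ` N" by blast
    qed
  qed
  moreover have "inj_on f N" using bij by (auto simp: bij_betw_def N_def intro: inj_on_subset)
  ultimately have "card N = card S" using card_image by metis
  then show ?thesis using card_digit_vectors[OF assms, of g j0 b] by (simp add: S_def N_def)
qed

text \<open>The difference of \<open>n(X)\<close> and \<open>x(X)\<close> occupies only the places
  from \<open>r\<close> to \<open>e - 1\<close>. If \<open>M\<close> were at least
  \<open>e - r + t\<close>, the vanishing of its first \<open>M\<close> fractional digits would
  contradict \<open>nonvanishing\<close> at offset \<open>r\<close>.\<close>

lemma agreement_bound:
  assumes "n < CARD('a) ^ m" "x < CARD('a) ^ m" "r < m"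
    and "\<And>i. i < r \<Longrightarrow> (dig n i :: 'a) = dig x i" "(dig n r :: 'a) \<noteq> dig x r"
    and "\<And>i. e \<le> i \<Longrightarrow> i < m \<Longrightarrow> (dig n i :: 'a) = dig x i"
    and "\<And>j. j < M \<Longrightarrow> fdig n j = fdig x j" "e \<le> m"
  shows "M + r < e + t"
proof (rule ccontr)
  assume M: "\<not> ?thesis"
  have re: "r < e" using assms(3,5,6) by (meson not_le_imp_less)
  \<comment> \<open>Read from place \<open>r\<close>, \<open>z\<close> has \<open>e - r\<close>
    relevant entries, and the lowest one, \<open>z r\<close>, is nonzero.\<close>
  define z where "z i = (dig n i - dig x i :: 'a)" for i
  have "\<exists>j<M. (\<Sum>i<e - r. z (r + i) * fls_nth theta (int (r + j + i + 1))) \<noteq> 0"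
    by (rule nonvanishing[of 0]) (use re assms M in \<open>auto simp: z_def\<close>)
  then obtain j where j: "j < M" "(\<Sum>i<e - r. z (r + i) * fls_nth theta (int (r + j + i + 1))) \<noteq> 0"
    by blast
  have "(\<Sum>i<e - r. z (r + i) * fls_nth theta (int (r + j + i + 1)))
      = (\<Sum>i\<in>{r..<e}. fls_nth theta (int (j + i + 1)) * z i)"
    by (rule sum.reindex_bij_witness[of _ "\<lambda>i. i - r" "\<lambda>i. r + i"]) (auto simp: algebra_simps)
  also have "\<dots> = (\<Sum>i<m. fls_nth theta (int (j + i + 1)) * z i)"
    using assms by (intro sum.mono_neutral_left) (auto simp: z_def)
  also have "\<dots> = fdig n j - fdig x j"
    unfolding fdig_eq[OF assms(1)] fdig_eq[OF assms(2)] z_def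
    by (simp add: sum_subtractf right_diff_distrib)
  also have "\<dots> = 0" using assms(7) j by simp
  finally show False using j by simp
qed

text \<open>Otherwise multiplication by \<open>X - 1\<close> kills the tail, so that \<open>theta\<close> is rational.\<close>

lemma fdig_not_eventually_minus_1: "\<exists>j\<ge>k. fdig n j \<noteq> - 1"
proof (rule ccontr)
  assume "\<not> ?thesis"
  then have tail: "fdig n j = - 1" if "j \<ge> k" for j using that by blast
  obtain m where m: "n < CARD('a) ^ m"
    using CARD_gt_1 real_arch_pow[of "real (CARD('a))" "real n"] by (auto simp flip: of_nat_power)
  \<comment> \<open>The \<open>m + 1\<close> coefficients of \<open>(X - 1) n(X)\<close>; its
    fractional digits are differences of consecutive digits of \<open>n\<close>.\<close>
  define z where "z i = (if i = 0 then 0 else dig n (i - 1)) - (if i < m then dig n i else 0 :: 'a)" for i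
  \<comment> \<open>If all of them vanished, so would \<open>n(X)\<close>, and its fractional digits
    would be 0 instead of -1.\<close>
  have "\<exists>i<Suc m. z i \<noteq> 0"
  proof (rule ccontr)
    assume "\<not> ?thesis"
    then have z0: "z i = 0" if "i < Suc m" for i using that by blast
    have d0: "(dig n i :: 'a) = 0" if "i < m" for i
      using that
    proof (induction i)
      case 0
      then show ?case using z0[of 0] by (simp add: z_def)
    next
      case (Suc i)
      then show ?case using z0[of "Suc i"] by (simp add: z_def)
    qed
    have "fdig n k = 0" unfolding fdig_eq[OF m] using d0 by (intro sum.neutral) auto
    then show False using tail[of k] by simp
  qed
  then obtain i0 where "i0 < Suc m" "z i0 \<noteq> 0" by blast
  then obtain i where "(\<Sum>j<Suc m. z j * fls_nth theta (int (k + i + j + 1))) \<noteq> 0"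
    using nonvanishing[of i0 "Suc m" z "Suc m + t" k] by blast
  moreover have "(\<Sum>j<Suc m. z j * fls_nth theta (int (k + i + j + 1)))
      = fdig n (Suc (k + i)) - fdig n (k + i)"
  proof -
    have "(\<Sum>j<Suc m. (if j = 0 then 0 else dig n (j - 1)) * fls_nth theta (int (k + i + j + 1)))
        = fdig n (Suc (k + i))"
      unfolding fdig_eq[OF m] by (subst sum.lessThan_Suc_shift) (simp add: algebra_simps)
    moreover have "(\<Sum>j<Suc m. (if j < m then dig n j else 0) * fls_nth theta (int (k + i + j + 1)))
        = fdig n (k + i)"
      unfolding fdig_eq[OF m] by (simp add: mult.commute)
    ultimately show ?thesis by (simp only: z_def left_diff_distrib sum_subtractf)
  qed
  ultimately show False using tail[of "k + i"] tail[of "Suc (k + i)"] by simp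
qed

end

section \<open>Comparison with a sparse digit string\<close>

text \<open>With places counted from 1, the ones stand at the multiples of \<open>D\<close>; this
  makes the number of digits up to and including a one a multiple of \<open>D\<close>.\<close>

definition comb :: "nat \<Rightarrow> nat \<Rightarrow> nat" where
  "comb D i = (if D dvd i + 1 then 1 else 0)"

definition tooth :: "nat \<Rightarrow> nat \<Rightarrow> nat" where
  "tooth D k = D * k + (D - 1)"

lemma Suc_tooth: "D > 0 \<Longrightarrow> Suc (tooth D k) = D * Suc k"
  by (simp add: tooth_def)

lemma comb_tooth: "D > 0 \<Longrightarrow> comb D (tooth D k) = 1"
  unfolding comb_def using Suc_tooth[of D k] by simp

lemma inj_tooth: "D > 0 \<Longrightarrow> inj (tooth D)"
  unfolding inj_def by (metis Suc_tooth mult_cancel1 nat.inject not_gr_zero)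

lemma tooth_image:
  assumes "D > 0"
  shows "tooth D ` {..<l} = {i. i < D * l \<and> D dvd i + 1}"
proof (intro equalityI subsetI)
  fix i assume "i \<in> tooth D ` {..<l}"
  then obtain k where k: "k < l" "i = tooth D k" by auto
  have "D * Suc k \<le> D * l" using k(1) by (intro mult_left_mono) auto
  then show "i \<in> {i. i < D * l \<and> D dvd i + 1}"
    using Suc_tooth[OF assms, of k] k(2) by auto
next
  fix i assume i: "i \<in> {i. i < D * l \<and> D dvd i + 1}"
  then obtain k where k: "Suc i = D * k" by auto
  then have "k \<noteq> 0" by (intro notI) auto
  then obtain k' where k': "k = Suc k'" by (cases k) auto
  have "i = tooth D k'" using Suc_tooth[OF assms, of k'] k k' by simp
  moreover have "D * k \<le> D * l" using i unfolding k[symmetric] by simp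
  then have "k \<le> l" using assms by (metis nat_mult_le_cancel1)
  then have "k' < l" using k' by simp
  ultimately show "i \<in> tooth D ` {..<l}" by blast
qed

lemma tooth_less: "D > 0 \<Longrightarrow> k < l \<Longrightarrow> tooth D k < D * l"
  using tooth_image[of D l] by blast

text \<open>A digit can only be smaller than the comb where the comb is 1, and then it must be 0.
  First drops below the comb thus occur at teeth only.\<close>

lemma less_comb_iff:
  assumes "D > 0"
  shows "(\<exists>r<D * l. P r \<and> d r < comb D r) \<longleftrightarrow> (\<exists>k<l. P (tooth D k) \<and> d (tooth D k) = 0)"
proof -
  have "(\<exists>r<D * l. P r \<and> d r < comb D r) \<longleftrightarrow> (\<exists>r\<in>tooth D ` {..<l}. P r \<and> d r = 0)"
    unfolding tooth_image[OF assms] by (auto simp: comb_def)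
  then show ?thesis by auto
qed

text \<open>The weight \<open>w\<close> stays general because the comb is used both directly after
  the radix point and further to the right.\<close>

lemma sum_comb:
  assumes "D > 0"
  shows "(\<Sum>i<D * l. real (comb D i) / w i) = (\<Sum>k<l. 1 / w (tooth D k))"
proof -
  have "(\<Sum>i<D * l. real (comb D i) / w i) = (\<Sum>i\<in>tooth D ` {..<l}. real (comb D i) / w i)"
    using tooth_image[OF assms, of l] by (intro sum.mono_neutral_right) (auto simp: comb_def)
  also have "\<dots> = (\<Sum>k<l. 1 / w (tooth D k))"
    using inj_tooth[OF assms] assms
    by (subst sum.reindex) (auto simp: comb_tooth inj_on_def inj_def)
  finally show ?thesis .
qed

lemma dval_less_power:
  assumes "\<And>i. i < k \<Longrightarrow> d i < b"
  shows "dval b d k < b ^ k"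
  using assms
proof (induction k)
  case (Suc k)
  have "b * dval b d k + d k < b * Suc (dval b d k)" using Suc.prems[of k] by simp
  also have "\<dots> \<le> b * b ^ k" using Suc by (intro mult_left_mono) (auto simp: Suc_le_eq)
  finally show ?case by simp
qed simp

text \<open>The injection splits \<open>i = a\<close> into \<open>b\<close> and \<open>a - b\<close>
  and takes their complements in \<open>l - 1\<close> as \<open>j\<close> and \<open>k\<close>,
  which gives \<open>l * (l + 1) / 2\<close> triples. They will index the largest empty
  boxes.\<close>

lemma card_triples_ge:
  "real l ^ 2 / 2 \<le> real (card {(i, j, k). i < l \<and> j < l \<and> k < l \<and> i + j + k + 2 = 2 * l})"
proof -
  let ?T = "{(i, j, k). i < l \<and> j < l \<and> k < l \<and> i + j + k + 2 = 2 * l}"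
  let ?A = "SIGMA a:{..<l}. {..a}"
  let ?f = "\<lambda>(a, b). (a, l - 1 - b, l - 1 - (a - b))"
  have "?T \<subseteq> {..<l} \<times> {..<l} \<times> {..<l}" by auto
  then have fin: "finite ?T" by (rule finite_subset) auto
  have "card ?A \<le> card ?T"
    by (rule card_inj_on_le[of ?f]) (use fin in \<open>auto simp: inj_on_def\<close>)
  moreover have "card ?A = (\<Sum>a<l. Suc a)" by simp
  moreover have "2 * (\<Sum>a<l. Suc a) = l * (l + 1)" by (induction l) auto
  moreover have "l ^ 2 \<le> l * (l + 1)" by (simp add: power2_eq_square)
  ultimately have "l ^ 2 \<le> 2 * card ?T" by linarith
  then have "real (l ^ 2) \<le> real (2 * card ?T)" by (rule of_nat_mono)
  then show ?thesis by simp
qed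

text \<open>One box bounds the supremum from below once the family is bounded above; each local
  discrepancy is at most 1 because both of its terms lie in \<open>[0, 1]\<close>.\<close>

lemma discrepancy2_ge:
  fixes x :: "nat \<Rightarrow> real \<times> real" and a1 b1 a2 b2 :: real
  assumes "0 \<le> a1" "a1 \<le> b1" "b1 \<le> 1" "0 \<le> a2" "a2 \<le> b2" "b2 \<le> 1" and N: "N > 0"
  shows "\<bar>real (card {n. n < N \<and> x n \<in> {a1..<b1} \<times> {a2..<b2}}) - real N * ((b1 - a1) * (b2 - a2))\<bar>
    \<le> real N * discrepancy2 N x"
proof -
  let ?f = "\<lambda>J :: (real \<times> real) \<times> (real \<times> real). case J of ((a1,b1),(a2,b2)) \<Rightarrow>
      \<bar>real (card {n. n < N \<and> x n \<in> {a1..<b1} \<times> {a2..<b2}}) / real N - (b1 - a1) * (b2 - a2)\<bar>"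
  let ?B = "{((a1 :: real,b1),(a2 :: real,b2)) | a1 b1 a2 b2.
        0 \<le> a1 \<and> a1 \<le> b1 \<and> b1 \<le> 1 \<and> 0 \<le> a2 \<and> a2 \<le> b2 \<and> b2 \<le> 1}"
  have "bdd_above (?f ` ?B)"
  proof (rule bdd_aboveI2)
    fix J assume "J \<in> ?B"
    then obtain a1 b1 a2 b2 :: real where J: "J = ((a1,b1),(a2,b2))" 
      "0 \<le> a1" "a1 \<le> b1" "b1 \<le> 1" "0 \<le> a2" "a2 \<le> b2" "b2 \<le> 1" by blast
    have "card {n. n < N \<and> x n \<in> {a1..<b1} \<times> {a2..<b2}} \<le> card {..<N}" by (intro card_mono) auto
    then have "real (card {n. n < N \<and> x n \<in> {a1..<b1} \<times> {a2..<b2}}) / real N \<le> 1"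
      using N by simp
    moreover have "0 \<le> real (card {n. n < N \<and> x n \<in> {a1..<b1} \<times> {a2..<b2}}) / real N" by simp
    moreover have "0 \<le> (b1 - a1) * (b2 - a2)" using J by simp
    moreover have "(b1 - a1) * (b2 - a2) \<le> 1 * 1" using J by (intro mult_mono) auto
    ultimately show "?f J \<le> 1" unfolding J(1) prod.case by linarith
  qed
  then have "?f ((a1,b1),(a2,b2)) \<le> discrepancy2 N x"
    unfolding discrepancy2_def by (intro cSUP_upper) (use assms in blast)+
  then have "real N * ?f ((a1,b1),(a2,b2)) \<le> real N * discrepancy2 N x"
    by (rule mult_left_mono) simp
  moreover have "real N * \<bar>c / real N - v\<bar> = \<bar>c - real N * v\<bar>" for c v :: real
  proof -
    have "real N * \<bar>c / real N - v\<bar> = \<bar>real N * (c / real N - v)\<bar>" by (simp add: abs_mult)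
    then show ?thesis using N by (simp add: right_diff_distrib)
  qed
  ultimately show ?thesis by (simp only: prod.case)
qed

section \<open>Coordinates of the sequence compared with finite expansions\<close>

lemma vdc_less_iff:
  assumes "p > 1"
  shows "vdc p n < real v / real p ^ k \<longleftrightarrow> dval p (\<lambda>i. n div p ^ i mod p) k < v"
  unfolding vdc_def
proof (rule expansion_less_dval_iff)
  \<comment> \<open>From place \<open>n\<close> on all digits of \<open>n\<close> are 0, so place
    \<open>max k n\<close> serves as the digit different from \<open>p - 1\<close>.\<close>
  have "n < 2 ^ n" by (rule less_exp)
  also have "(2::nat) ^ n \<le> p ^ n" using assms by (intro power_mono) auto
  also have "\<dots> \<le> p ^ max k n" using assms by (intro power_increasing) auto
  finally show "n div p ^ max k n mod p \<noteq> p - 1" using assms by simp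
qed (use assms in auto)

lemma vdc_nonneg: "0 \<le> vdc p n"
proof (cases "p > 1")
  case True
  then show ?thesis using dval_le_expansion(1)[of p "\<lambda>i. n div p ^ i mod p" 0] by (simp add: vdc_def)
next
  \<comment> \<open>For \<open>p = 0\<close> every term is a division by zero, with value 0; for
    \<open>p = 1\<close> every digit is 0.\<close>
  case False
  have "summable (\<lambda>i. real (n div p ^ i mod p) / real p ^ (i + 1))"
  proof (cases "p = 0")
    case True
    have "(\<lambda>i. real (n div p ^ i mod p) / real p ^ (i + 1)) = (\<lambda>i. 0)" using True by auto
    then show ?thesis by simp
  next
    case p: False
    then have "p = 1" using False by simp
    then show ?thesis by simp
  qed
  then show ?thesis unfolding vdc_def by (intro suminf_nonneg) auto
qed

context badly_approximable
begin

text \<open>The representative of -1 is \<open>CARD('a) - 1\<close>, so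
  \<open>fdig_not_eventually_minus_1\<close> excludes the ambiguous tail of maximal digits.\<close>

lemma eval_less_iff:
  "eval_at_p (lf_frac (theta * digit_poly_fls n)) < real v / real CARD('a) ^ k \<longleftrightarrow>
    dval CARD('a) (\<lambda>j. fp_rep (fdig n j)) k < v"
proof -
  obtain j where j: "j \<ge> k" "fdig n j \<noteq> - 1" using fdig_not_eventually_minus_1 by blast
  have "(of_nat (CARD('a) - 1) :: 'a) = - 1"
    using CARD_gt_1 of_nat_CHAR[where 'a='a] by (simp add: CHAR_eq_CARD[OF prime_CARD] of_nat_diff)
  then have "fp_rep (fdig n j) \<noteq> CARD('a) - 1" using j(2) fp_rep(2)[OF prime_CARD, of "fdig n j"] by auto
  then show ?thesis
    unfolding eval_at_p_def fdig_def[symmetric]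
    by (intro expansion_less_dval_iff[where j = j] CARD_gt_1 fp_rep(1)[OF prime_CARD] j(1))
qed

text \<open>
  The number of digits prescribed by an elementary box is a multiple of the stride, up to a constant. No such number
  lies strictly between \<open>m - t\<close>, the limit for an exact count, and \<open>m + t + 3\<close>, where boxes become empty.
\<close>

definition stride :: nat where "stride = 2 * t + 3"

lemma stride_pos: "stride > 0" by (simp add: stride_def)

text \<open>The least \<open>m\<close> for which three windows of length
  \<open>h = stride * l\<close> can be prescribed at once: the condition for an exact count reads
  \<open>2 * h + t \<le> m - h\<close>.\<close>

definition height :: "nat \<Rightarrow> nat" where "height l = 3 * (stride * l) + t"

text \<open>A box with a nonzero point count is inhabited. The fractional window starts at place
  \<open>h\<close>, so that the number of digits prescribed by an elementary box can pass
  \<open>m - t = 3 * h\<close>; from place 0 it would stay at most \<open>3 * h\<close>, and every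
  box would hold its exact share.\<close>

lemma ex_reference_point:
  "\<exists>x<CARD('a) ^ height l. (\<forall>i<stride * l. dig x i = (of_nat (comb stride i) :: 'a)) \<and>
    (\<forall>i<stride * l. dig x (height l - 1 - i) = (of_nat (comb stride i) :: 'a)) \<and>
    (\<forall>i<stride * l. fdig x (stride * l + i) = of_nat (comb stride i))"
proof -
  define h where "h = stride * l"
  define m where "m = height l"
  have m: "m = 3 * h + t" by (simp add: m_def h_def height_def)
  define g where "g i = (of_nat (if i < h then comb stride i else comb stride (m - 1 - i)) :: 'a)" for i
  define b where "b j = (of_nat (comb stride (j - h)) :: 'a)" for j
  let ?N = "{n. n < CARD('a) ^ m \<and> (\<forall>i<h. dig n i = g i) \<and> (\<forall>i\<in>{m - h..<m}. dig n i = g i) \<and>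
      (\<forall>j\<in>{h..<h + h}. fdig n j = b j)}"
  have "card ?N * CARD('a) ^ (h + (m - (m - h)) + h) = CARD('a) ^ m"
    by (rule card_elementary_box) (auto simp: m)
  then have "card ?N \<noteq> 0" using CARD_gt_1 by (metis mult_0 not_one_less_zero power_not_zero)
  then have "?N \<noteq> {}" by (metis card.empty)
  then obtain x where x: "x \<in> ?N" by blast
  have "dig x i = (of_nat (comb stride i) :: 'a)" if "i < h" for i
    using x that by (simp add: g_def)
  moreover have "dig x (m - 1 - i) = (of_nat (comb stride i) :: 'a)" if "i < h" for i
  proof -
    have i: "m - 1 - i \<in> {m - h..<m}" "\<not> m - 1 - i < h" "m - 1 - (m - 1 - i) = i" using that m by auto
    then have "dig x (m - 1 - i) = g (m - 1 - i)" using x by blast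
    then show ?thesis using i by (simp add: g_def)
  qed
  moreover have "fdig x (h + i) = of_nat (comb stride i)" if "i < h" for i
    using x that by (simp add: b_def)
  ultimately show ?thesis using x unfolding h_def[symmetric] m_def[symmetric] by blast
qed

end

lemma first_difference_unique:
  fixes a a' :: nat
  assumes "\<forall>r<a. d r = e r" "d a \<noteq> e a" "\<forall>r<a'. d r = e r" "d a' \<noteq> e a'"
  shows "a = a'"
  using assms by (metis linorder_neqE_nat)

section \<open>The elementary boxes below the reference point\<close>

locale reference_point = badly_approximable theta t
  for theta :: "'a::{field,finite} fls" and t :: nat +
  fixes l x :: nat
  assumes l_pos: "l > 0"
    and x_less: "x < CARD('a) ^ height l"
    and low_digits: "\<And>i. i < stride * l \<Longrightarrow> dig x i = (of_nat (comb stride i) :: 'a)"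
    and top_digits: "\<And>i. i < stride * l \<Longrightarrow> dig x (height l - 1 - i) = (of_nat (comb stride i) :: 'a)"
    and mid_digits: "\<And>i. i < stride * l \<Longrightarrow> fdig x (stride * l + i) = of_nat (comb stride i)"
begin

abbreviation m where "m \<equiv> height l"
abbreviation h where "h \<equiv> stride * l"
abbreviation \<rho> where "\<rho> \<equiv> tooth stride"
abbreviation \<kappa> where "\<kappa> \<equiv> comb stride"

lemma m_eq: "m = 3 * h + t" by (simp add: height_def)

lemma \<kappa>_less: "\<kappa> i < CARD('a)" using CARD_gt_1 by (simp add: comb_def)

lemma \<rho>_less: "i < l \<Longrightarrow> \<rho> i < h" using tooth_less stride_pos by blast

lemma \<kappa>_\<rho>: "\<kappa> (\<rho> i) = 1" using comb_tooth stride_pos by blast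

lemma dig_eq_of_nat_iff: "a < CARD('a) \<Longrightarrow> (dig n i :: 'a) = of_nat a \<longleftrightarrow> n div CARD('a) ^ i mod CARD('a) = a"
  unfolding dig_def using CARD_gt_1 by (subst of_nat_CARD_eq_iff[OF prime_CARD]) auto

lemma dig_eq_0_iff: "(dig n i :: 'a) = 0 \<longleftrightarrow> n div CARD('a) ^ i mod CARD('a) = 0"
  using dig_eq_of_nat_iff[of 0 n i] CARD_gt_1 by simp

text \<open>The index is the tooth at which the respective string of \<open>n\<close> first drops
  below that of \<open>x\<close>. \<open>frac_box\<close> refers to \<open>fdig x\<close> because
  the fractional digits of \<open>x\<close> before the window are arbitrary.\<close>

definition top_box where
  "top_box i = {n. (\<forall>r<\<rho> i. n div CARD('a) ^ (m - 1 - r) mod CARD('a) = \<kappa> r) \<and> n div CARD('a) ^ (m - 1 - \<rho> i) mod CARD('a) = 0}"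

definition low_box where
  "low_box j = {n. (\<forall>r<\<rho> j. n div CARD('a) ^ r mod CARD('a) = \<kappa> r) \<and> n div CARD('a) ^ \<rho> j mod CARD('a) = 0}"

definition frac_box where
  "frac_box k = {n. (\<forall>r<h + \<rho> k. fdig n r = fdig x r) \<and> fdig n (h + \<rho> k) = 0}"

definition elem_box where
  "elem_box i j k = {n. n < CARD('a) ^ m} \<inter> top_box i \<inter> low_box j \<inter> frac_box k"

lemma finite_box: "finite (elem_box i j k)"
  by (rule finite_subset[of _ "{n. n < CARD('a) ^ m}"]) (auto simp: elem_box_def)

lemma teeth_sum: "(\<rho> i + 1) + (\<rho> j + 1) + (\<rho> k + 1) = stride * (i + j + k + 3)"
  using Suc_tooth[OF stride_pos] by (simp add: algebra_simps)

text \<open>The condition on the free block in \<open>card_elementary_box\<close> amounts to the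
  three prescribed parts of the windows having total length at most \<open>2 * h\<close>, which is
  the assumption on \<open>i + j + k\<close>.\<close>

lemma card_box:
  assumes "i < l" "j < l" "k < l" "i + j + k + 3 \<le> 2 * l"
  shows "card (elem_box i j k) * CARD('a) ^ (stride * (i + j + k + 3) + h) = CARD('a) ^ m"
proof -
  define e where "e = m - (\<rho> i + 1)"
  \<comment> \<open>One function holds both the low and the top digits; the two windows do not
    overlap since \<open>m\<close> is at least \<open>2 * h\<close>.\<close>
  define g :: "nat \<Rightarrow> 'a" where "g r = (if r < \<rho> j then of_nat (\<kappa> r) else if r = \<rho> j then 0
    else if r = m - 1 - \<rho> i then 0 else of_nat (\<kappa> (m - 1 - r)))" for r
  define b :: "nat \<Rightarrow> 'a" where "b r = (if r = h + \<rho> k then 0 else fdig x r)" for r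
  have ij: "\<rho> i < h" "\<rho> j < h" "\<rho> k < h" using assms \<rho>_less by auto
  have "stride * (i + j + k + 3) \<le> stride * (2 * l)" using assms by (intro mult_left_mono) auto
  then have sum_le: "(\<rho> i + 1) + (\<rho> j + 1) + (\<rho> k + 1) \<le> 2 * h" unfolding teeth_sum by simp
  have low: "(\<forall>r<\<rho> j + 1. dig n r = g r) \<longleftrightarrow> n \<in> low_box j" for n
    by (auto simp: g_def low_box_def less_Suc_eq dig_eq_of_nat_iff \<kappa>_less dig_eq_0_iff)
  have top: "(\<forall>r\<in>{e..<m}. dig n r = g r) \<longleftrightarrow> n \<in> top_box i" for n
  proof -
    have "(\<forall>r\<in>{e..<m}. dig n r = g r) \<longleftrightarrow> (\<forall>r<\<rho> i + 1. dig n (m - 1 - r) = g (m - 1 - r))"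
    proof safe
      fix r assume *: "\<forall>r\<in>{e..<m}. dig n r = g r" "r < \<rho> i + 1"
      have "m - 1 - r \<in> {e..<m}" using * ij by (auto simp: e_def m_eq)
      then show "dig n (m - 1 - r) = g (m - 1 - r)" using * by blast
    next
      fix r assume *: "\<forall>r<\<rho> i + 1. dig n (m - 1 - r) = g (m - 1 - r)" "r \<in> {e..<m}"
      have "m - 1 - r < \<rho> i + 1" "m - 1 - (m - 1 - r) = r" using * ij by (auto simp: e_def)
      then show "dig n r = g r" using * by metis
    qed
    also have "\<dots> \<longleftrightarrow> (\<forall>r<\<rho> i + 1. dig n (m - 1 - r) = (if r = \<rho> i then 0 else of_nat (\<kappa> r) :: 'a))"
    proof -
      have "g (m - 1 - r) = (if r = \<rho> i then 0 else of_nat (\<kappa> r))" if "r < \<rho> i + 1" for r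
      proof -
        have "\<not> m - 1 - r < \<rho> j" "m - 1 - r \<noteq> \<rho> j" "m - 1 - (m - 1 - r) = r"
          "m - 1 - r = m - 1 - \<rho> i \<longleftrightarrow> r = \<rho> i" using that ij by (auto simp: m_eq)
        then show ?thesis by (simp add: g_def)
      qed
      then show ?thesis by auto
    qed
    also have "\<dots> \<longleftrightarrow> n \<in> top_box i"
      by (auto simp: top_box_def less_Suc_eq dig_eq_of_nat_iff \<kappa>_less dig_eq_0_iff)
    finally show ?thesis .
  qed
  have frac: "(\<forall>r\<in>{0..<0 + (h + \<rho> k + 1)}. fdig n r = b r) \<longleftrightarrow> n \<in> frac_box k" for n
    by (auto simp: b_def frac_box_def less_Suc_eq)
  have c1: "elem_box i j k = {n. n < CARD('a) ^ m \<and> (\<forall>r<\<rho> j + 1. dig n r = g r) \<and> (\<forall>r\<in>{e..<m}. dig n r = g r) \<and>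
      (\<forall>r\<in>{0..<0 + (h + \<rho> k + 1)}. fdig n r = b r)}"
    unfolding low top frac by (auto simp: elem_box_def)
  have c2: "card {n. n < CARD('a) ^ m \<and> (\<forall>r<\<rho> j + 1. dig n r = g r) \<and> (\<forall>r\<in>{e..<m}. dig n r = g r) \<and>
      (\<forall>r\<in>{0..<0 + (h + \<rho> k + 1)}. fdig n r = b r)} * CARD('a) ^ ((\<rho> j + 1) + (m - e) + (h + \<rho> k + 1)) = CARD('a) ^ m"
    by (rule card_elementary_box) (use sum_le ij in \<open>auto simp: e_def m_eq\<close>)
  have c3: "(\<rho> j + 1) + (m - e) + (h + \<rho> k + 1) = stride * (i + j + k + 3) + h"
    using ij by (auto simp: e_def m_eq teeth_sum[symmetric])
  show ?thesis using c2 unfolding c1 c3 .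
qed

text \<open>A point in the box would give
  \<open>\<rho> i + \<rho> j + \<rho> k < 2 * h + 2 * t\<close> by \<open>agreement_bound\<close>,
  whereas the assumption makes this sum at least \<open>2 * h + stride - 3\<close>. The value
  \<open>stride = 2 * t + 3\<close> is just large enough for a contradiction.\<close>

lemma box_empty:
  assumes "i < l" "j < l" "k < l" "i + j + k + 3 > 2 * l"
  shows "elem_box i j k = {}"
proof (rule ccontr)
  assume "elem_box i j k \<noteq> {}"
  then obtain n where n: "n < CARD('a) ^ m" "n \<in> top_box i" "n \<in> low_box j" "n \<in> frac_box k"
    by (auto simp: elem_box_def)
  have ij: "\<rho> i < h" "\<rho> j < h" "\<rho> k < h" using assms \<rho>_less by auto
  have "(h + \<rho> k) + \<rho> j < (m - \<rho> i) + t"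
  proof (rule agreement_bound[OF n(1) x_less])
    show "\<rho> j < m" "m - \<rho> i \<le> m" using ij by (auto simp: m_eq)
    show "(dig n r :: 'a) = dig x r" if "r < \<rho> j" for r
    proof -
      have "n div CARD('a) ^ r mod CARD('a) = \<kappa> r" using that n(3) by (simp add: low_box_def)
      then have "(dig n r :: 'a) = of_nat (\<kappa> r)" by (rule dig_eq_of_nat_iff[OF \<kappa>_less, THEN iffD2])
      then show ?thesis using low_digits[of r] that ij by simp
    qed
    show "(dig n (\<rho> j) :: 'a) \<noteq> dig x (\<rho> j)"
      using n(3) ij low_digits[of "\<rho> j"] by (simp add: low_box_def \<kappa>_\<rho> dig_eq_0_iff[symmetric])
    show "(dig n r :: 'a) = dig x r" if "m - \<rho> i \<le> r" "r < m" for r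
    proof -
      have r: "m - 1 - r < \<rho> i" "m - 1 - (m - 1 - r) = r" using that ij by (auto simp: m_eq)
      then have "n div CARD('a) ^ r mod CARD('a) = \<kappa> (m - 1 - r)" using n(2) unfolding top_box_def by force
      moreover have "dig x r = (of_nat (\<kappa> (m - 1 - r)) :: 'a)"
        using top_digits[of "m - 1 - r"] r ij by simp
      ultimately show ?thesis using dig_eq_of_nat_iff[OF \<kappa>_less, THEN iffD2] by metis
    qed
    show "fdig n r = fdig x r" if "r < h + \<rho> k" for r
      using that n(4) by (simp add: frac_box_def)
  qed
  then have "h + (\<rho> i + \<rho> j + \<rho> k) < 3 * h + 2 * t" using ij unfolding m_eq by linarith
  moreover have "stride * (2 * l + 1) \<le> stride * (i + j + k + 3)"
    using assms by (intro mult_left_mono) auto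
  then have "2 * h + stride \<le> (\<rho> i + 1) + (\<rho> j + 1) + (\<rho> k + 1)" unfolding teeth_sum by simp
  moreover have "stride = 2 * t + 3" by (rule stride_def)
  ultimately show False by linarith
qed

text \<open>At the tooth in question \<open>x\<close> has digit 1 and \<open>n\<close> has digit 0,
  so each index is determined by a place of first difference.\<close>

lemma boxes_disjoint:
  assumes "i < l" "j < l" "k < l" "i' < l" "j' < l" "k' < l"
    and n: "n \<in> elem_box i j k" "n \<in> elem_box i' j' k'"
  shows "i = i' \<and> j = j' \<and> k = k'"
proof -
  have "\<rho> i = \<rho> i'"
    by (rule first_difference_unique[of _ "\<lambda>r. n div CARD('a) ^ (m - 1 - r) mod CARD('a)" \<kappa>])
      (use n in \<open>auto simp: elem_box_def top_box_def \<kappa>_\<rho>\<close>)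
  moreover have "\<rho> j = \<rho> j'"
    by (rule first_difference_unique[of _ "\<lambda>r. n div CARD('a) ^ r mod CARD('a)" \<kappa>])
      (use n in \<open>auto simp: elem_box_def low_box_def \<kappa>_\<rho>\<close>)
  moreover have "fdig x (h + \<rho> k) = 1" if "k < l" for k
    using mid_digits[of "\<rho> k"] \<rho>_less[OF that] by (simp add: \<kappa>_\<rho>)
  then have "h + \<rho> k = h + \<rho> k'"
    by (intro first_difference_unique[of _ "fdig n" "fdig x"])
      (use n assms(3,6) in \<open>auto simp: elem_box_def frac_box_def\<close>)
  ultimately show ?thesis using inj_tooth[OF stride_pos] by (simp add: inj_eq)
qed

section \<open>The test box and its points\<close>

definition num where "num = CARD('a) ^ (m - h) * dval CARD('a) \<kappa> h"
definition side where "side = real (dval CARD('a) \<kappa> h) / real CARD('a) ^ h"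
text \<open>\<open>num / CARD('a) ^ m\<close>, \<open>side\<close> and \<open>hi\<close> are the
  strings of \<open>x\<close> truncated at the ends of the windows. \<open>lo\<close> cuts the third
  string where its window begins, which forces agreement with \<open>x\<close> up to there.\<close>

definition lo where "lo = real (dval CARD('a) (\<lambda>r. fp_rep (fdig x r)) h) / real CARD('a) ^ h"
definition hi where "hi = real (dval CARD('a) (\<lambda>r. fp_rep (fdig x r)) (h + h)) / real CARD('a) ^ (h + h)"

lemma num_le: "num \<le> CARD('a) ^ m"
proof -
  have "num \<le> CARD('a) ^ (m - h) * CARD('a) ^ h"
    unfolding num_def using dval_less_power[of h \<kappa> "CARD('a)"] \<kappa>_less
    by (intro mult_left_mono) (auto intro: less_imp_le)
  also have "\<dots> = CARD('a) ^ m" by (simp add: power_add[symmetric] m_eq mult.commute)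
  finally show ?thesis .
qed

text \<open>As a multiple of \<open>CARD('a) ^ (m - h)\<close>, \<open>num\<close> only tests the
  leading \<open>h\<close> digits. The number of points thus acts as one more box side.\<close>

lemma less_num_iff:
  assumes "n < CARD('a) ^ m"
  shows "n < num \<longleftrightarrow> (\<exists>i<l. n \<in> top_box i)"
proof -
  let ?d = "\<lambda>r. n div CARD('a) ^ (m - 1 - r) mod CARD('a)"
  have "n < num \<longleftrightarrow> n div CARD('a) ^ (m - h) < dval CARD('a) \<kappa> h"
    using CARD_gt_1 by (simp add: num_def div_less_iff_less_mult mult.commute)
  also have "n div CARD('a) ^ (m - h) = dval CARD('a) ?d h"
    using assms by (intro dval_top_digits[symmetric]) (auto simp: m_eq)
  also have "dval CARD('a) ?d h < dval CARD('a) \<kappa> h \<longleftrightarrow> (\<exists>r<h. (\<forall>s<r. ?d s = \<kappa> s) \<and> ?d r < \<kappa> r)"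
    using CARD_gt_1 by (intro dval_less_iff \<kappa>_less) auto
  also have "\<dots> \<longleftrightarrow> (\<exists>i<l. (\<forall>s<\<rho> i. ?d s = \<kappa> s) \<and> ?d (\<rho> i) = 0)"
    using stride_pos by (rule less_comb_iff)
  finally show ?thesis by (simp add: top_box_def)
qed

lemma vdc_less_side_iff: "vdc CARD('a) n < side \<longleftrightarrow> (\<exists>j<l. n \<in> low_box j)"
proof -
  let ?d = "\<lambda>r. n div CARD('a) ^ r mod CARD('a)"
  have "vdc CARD('a) n < side \<longleftrightarrow> dval CARD('a) ?d h < dval CARD('a) \<kappa> h"
    unfolding side_def using CARD_gt_1 by (rule vdc_less_iff)
  also have "\<dots> \<longleftrightarrow> (\<exists>r<h. (\<forall>s<r. ?d s = \<kappa> s) \<and> ?d r < \<kappa> r)"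
    using CARD_gt_1 by (intro dval_less_iff \<kappa>_less) auto
  also have "\<dots> \<longleftrightarrow> (\<exists>i<l. (\<forall>s<\<rho> i. ?d s = \<kappa> s) \<and> ?d (\<rho> i) = 0)"
    using stride_pos by (rule less_comb_iff)
  finally show ?thesis by (simp add: low_box_def)
qed

lemma fp_rep_mid: "i < h \<Longrightarrow> fp_rep (fdig x (h + i)) = \<kappa> i"
  using mid_digits[of i] \<kappa>_less[of i] by (simp add: fp_rep_of_nat[OF prime_CARD])

text \<open>Being below \<open>hi\<close> means a first drop below \<open>x\<close> among the first
  \<open>2 * h\<close> digits, and not being below \<open>lo\<close> rules out the first
  \<open>h\<close> of them; the drop is therefore at a tooth of the window.\<close>

lemma eval_between_iff:
  "lo \<le> eval_at_p (lf_frac (theta * digit_poly_fls n)) \<and> eval_at_p (lf_frac (theta * digit_poly_fls n)) < hi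
    \<longleftrightarrow> (\<exists>k<l. n \<in> frac_box k)"
proof -
  let ?d = "\<lambda>r. fp_rep (fdig n r)" and ?e = "\<lambda>r. fp_rep (fdig x r)"
  let ?y = "eval_at_p (lf_frac (theta * digit_poly_fls n))"
  let ?lex = "\<lambda>r. (\<forall>s<r. ?d s = ?e s) \<and> ?d r < ?e r"
  have less: "dval CARD('a) ?d a < dval CARD('a) ?e a \<longleftrightarrow> (\<exists>r<a. ?lex r)" for a
    by (intro dval_less_iff fp_rep(1)[OF prime_CARD])
  have "lo \<le> ?y \<longleftrightarrow> \<not> (\<exists>r<h. ?lex r)"
    unfolding less[symmetric] lo_def not_less[symmetric] eval_less_iff by (rule refl)
  moreover have "?y < hi \<longleftrightarrow> (\<exists>r<h + h. ?lex r)"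
    unfolding less[symmetric] hi_def eval_less_iff by (rule refl)
  moreover have "\<not> (\<exists>r<h. ?lex r) \<and> (\<exists>r<h + h. ?lex r) \<longleftrightarrow> (\<exists>r<h. ?lex (h + r))"
  proof
    assume *: "\<not> (\<exists>r<h. ?lex r) \<and> (\<exists>r<h + h. ?lex r)"
    then obtain r where r: "r < h + h" "?lex r" by blast
    with * have "h \<le> r" by (meson not_le_imp_less)
    then obtain r' where "r = h + r'" using le_Suc_ex by blast
    with r show "\<exists>r<h. ?lex (h + r)" by auto
  next
    assume "\<exists>r<h. ?lex (h + r)"
    then obtain r where r: "r < h" "?lex (h + r)" by blast
    then have "\<not> ?lex s" if "s < h" for s using that by (metis less_irrefl trans_less_add1)
    moreover have "h + r < h + h" using r(1) by simp
    ultimately show "\<not> (\<exists>r<h. ?lex r) \<and> (\<exists>r<h + h. ?lex r)" using r(2) by blast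
  qed
  moreover have "(\<exists>r<h. ?lex (h + r)) \<longleftrightarrow> (\<exists>r<h. (\<forall>s<h + r. ?d s = ?e s) \<and> ?d (h + r) < \<kappa> r)"
    using fp_rep_mid by auto
  moreover have "\<dots> \<longleftrightarrow> (\<exists>k<l. (\<forall>s<h + \<rho> k. ?d s = ?e s) \<and> ?d (h + \<rho> k) = 0)"
    using stride_pos by (rule less_comb_iff)
  moreover have "?d r = 0 \<longleftrightarrow> fdig n r = 0" for r
    using fp_rep_eq_iff[OF prime_CARD, of "fdig n r" 0] fp_rep_of_nat[OF prime_CARD, of 0] CARD_gt_1
    by simp
  ultimately show ?thesis by (simp add: frac_box_def fp_rep_eq_iff[OF prime_CARD])
qed

lemma points_in_box:
  "{n. n < num \<and> (vdc CARD('a) n, eval_at_p (lf_frac (theta * digit_poly_fls n))) \<in> {0..<side} \<times> {lo..<hi}}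
    = (\<Union>(i, j, k)\<in>{..<l} \<times> {..<l} \<times> {..<l}. elem_box i j k)"
proof -
  have "n < num \<longleftrightarrow> n < CARD('a) ^ m \<and> (\<exists>i<l. n \<in> top_box i)" for n
    using less_num_iff[of n] num_le by auto
  then show ?thesis
    by (auto simp: vdc_nonneg vdc_less_side_iff eval_between_iff elem_box_def)
qed

lemma card_points_in_box:
  "card {n. n < num \<and> (vdc CARD('a) n, eval_at_p (lf_frac (theta * digit_poly_fls n))) \<in> {0..<side} \<times> {lo..<hi}}
    = (\<Sum>(i, j, k)\<in>{..<l} \<times> {..<l} \<times> {..<l}. card (elem_box i j k))"
proof -
  have "card (\<Union>K\<in>{..<l} \<times> {..<l} \<times> {..<l}. case K of (i, j, k) \<Rightarrow> elem_box i j k)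
      = (\<Sum>K\<in>{..<l} \<times> {..<l} \<times> {..<l}. card (case K of (i, j, k) \<Rightarrow> elem_box i j k))"
  proof (rule card_UN_disjoint)
    show "\<forall>K\<in>{..<l} \<times> {..<l} \<times> {..<l}. finite (case K of (i, j, k) \<Rightarrow> elem_box i j k)"
      by (auto simp: finite_box)
    show "\<forall>K\<in>{..<l} \<times> {..<l} \<times> {..<l}. \<forall>K'\<in>{..<l} \<times> {..<l} \<times> {..<l}. K \<noteq> K' \<longrightarrow>
        (case K of (i, j, k) \<Rightarrow> elem_box i j k) \<inter> (case K' of (i, j, k) \<Rightarrow> elem_box i j k) = {}"
      using boxes_disjoint by (clarsimp simp: disjoint_iff)
  qed auto
  then show ?thesis unfolding points_in_box by (simp add: case_prod_unfold)
qed

section \<open>Expected numbers of points and the deficit\<close>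

lemma side_eq: "side = (\<Sum>k<l. 1 / real CARD('a) ^ (\<rho> k + 1))"
proof -
  have "side = (\<Sum>i<h. real (\<kappa> i) / real CARD('a) ^ (i + 1))"
    unfolding side_def using CARD_gt_1 by (intro real_dval) auto
  then show ?thesis using sum_comb[OF stride_pos, where l = l and w = "\<lambda>i. real CARD('a) ^ (i + 1)"] by simp
qed

lemma num_eq: "real num = real CARD('a) ^ m * side"
proof -
  have "real CARD('a) ^ m = real CARD('a) ^ (m - h) * real CARD('a) ^ h" by (simp add: power_add[symmetric] m_eq mult.commute)
  then show ?thesis using CARD_gt_1 by (simp add: num_def side_def)
qed

lemma hi_minus_lo: "hi - lo = (\<Sum>k<l. 1 / real CARD('a) ^ (h + \<rho> k + 1))"
proof -
  let ?f = "\<lambda>i. real (fp_rep (fdig x i)) / real CARD('a) ^ (i + 1)"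
  have "real (dval CARD('a) (\<lambda>r. fp_rep (fdig x r)) a) / real CARD('a) ^ a = (\<Sum>i<a. ?f i)" for a
    using CARD_gt_1 by (intro real_dval) simp
  then have lh: "lo = (\<Sum>i<h. ?f i)" "hi = (\<Sum>i<h + h. ?f i)" by (simp_all only: lo_def hi_def)
  have "(\<Sum>i<h + a. ?f i) = (\<Sum>i<h. ?f i) + (\<Sum>i<a. ?f (h + i))" for a
    by (induction a) simp_all
  then have "hi - lo = (\<Sum>i<h. ?f (h + i))" unfolding lh by simp
  also have "\<dots> = (\<Sum>i<h. real (\<kappa> i) / real CARD('a) ^ (h + i + 1))"
    by (intro sum.cong) (auto simp: fp_rep_mid)
  also have "\<dots> = (\<Sum>k<l. 1 / real CARD('a) ^ (h + \<rho> k + 1))" by (rule sum_comb[OF stride_pos])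
  finally show ?thesis .
qed

text \<open>The product of three sums over teeth expands into one term per elementary box, namely
  its expected number of points.\<close>

lemma volume_eq:
  "real num * ((side - 0) * (hi - lo)) =
    (\<Sum>(i, j, k)\<in>{..<l} \<times> {..<l} \<times> {..<l}. real CARD('a) ^ m / real CARD('a) ^ (stride * (i + j + k + 3) + h))"
proof -
  have "real num * ((side - 0) * (hi - lo)) = real CARD('a) ^ m * (\<Sum>i<l. \<Sum>j<l. \<Sum>k<l.
      1 / real CARD('a) ^ (\<rho> i + 1) * (1 / real CARD('a) ^ (\<rho> j + 1) * (1 / real CARD('a) ^ (h + \<rho> k + 1))))"
    unfolding num_eq hi_minus_lo side_eq
    by (simp only: sum_distrib_left[symmetric] sum_distrib_right[symmetric] diff_0_right mult.assoc)
  also have "\<dots> = (\<Sum>i<l. \<Sum>j<l. \<Sum>k<l. real CARD('a) ^ m / real CARD('a) ^ (stride * (i + j + k + 3) + h))"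
    unfolding sum_distrib_left
    by (intro sum.cong refl) (simp add: teeth_sum[symmetric] power_add)
  finally show ?thesis by (simp add: sum.cartesian_product)
qed

text \<open>Expected minus actual count is 0 for large boxes and the full expectation for empty
  ones, so no cancellation occurs. Only the empty boxes with
  \<open>i + j + k + 3 = 2 * l + 1\<close> are kept.\<close>

lemma deficit:
  "real l ^ 2 / 2 / real CARD('a) ^ (t + 3) \<le> real num * ((side - 0) * (hi - lo)) -
    real (card {n. n < num \<and> (vdc CARD('a) n, eval_at_p (lf_frac (theta * digit_poly_fls n))) \<in> {0..<side} \<times> {lo..<hi}})"
proof -
  let ?T = "{..<l} \<times> {..<l} \<times> {..<l}"
  let ?T' = "{(i, j, k). i < l \<and> j < l \<and> k < l \<and> i + j + k + 2 = 2 * l}"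
  let ?v = "\<lambda>(i, j, k). real CARD('a) ^ m / real CARD('a) ^ (stride * (i + j + k + 3) + h)"
  let ?c = "\<lambda>(i, j, k). real (card (elem_box i j k))"
  have p0: "real CARD('a) > 0" using CARD_gt_1 by simp
  have "?v (i, j, k) = 1 / real CARD('a) ^ (t + 3)" "?c (i, j, k) = 0" if "(i, j, k) \<in> ?T'" for i j k
  proof -
    have "i + j + k + 3 = 2 * l + 1" using that by auto
    then have "stride * (i + j + k + 3) + h = stride * (2 * l + 1) + h" by (simp only:)
    \<comment> \<open>Here \<open>3 * h + stride = (3 * h + t) + (t + 3)\<close>, so each kept box
      has expectation \<open>1 / CARD('a) ^ (t + 3)\<close>.\<close>
    also have "\<dots> = m + (t + 3)" by (simp add: m_eq stride_def algebra_simps)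
    finally have e: "stride * (i + j + k + 3) + h = m + (t + 3)" .
    show "?v (i, j, k) = 1 / real CARD('a) ^ (t + 3)"
      unfolding prod.case e power_add[of _ m] using p0 by simp
    show "?c (i, j, k) = 0" using that box_empty[of i j k] by simp
  qed
  then have eq: "?v K - ?c K = 1 / real CARD('a) ^ (t + 3)" if "K \<in> ?T'" for K
    using that by (cases K) simp
  have nonneg: "?v K - ?c K \<ge> 0" if K_in: "K \<in> ?T" for K
  proof -
    obtain i j k where K: "K = (i, j, k)" "i < l" "j < l" "k < l" using K_in by auto
    show ?thesis
    proof (cases "i + j + k + 3 \<le> 2 * l")
      case True
      have "real (card (elem_box i j k)) * real CARD('a) ^ (stride * (i + j + k + 3) + h) = real CARD('a) ^ m"
        using card_box[OF K(2-4) True] by (metis of_nat_mult of_nat_power)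
      then have "real (card (elem_box i j k)) = real CARD('a) ^ m / real CARD('a) ^ (stride * (i + j + k + 3) + h)"
        using p0 by (simp add: field_simps)
      then show ?thesis using K(1) by simp
    next
      case False
      then show ?thesis using box_empty[OF K(2-4)] K(1) by simp
    qed
  qed
  have "real l ^ 2 / 2 / real CARD('a) ^ (t + 3) \<le> real (card ?T') * (1 / real CARD('a) ^ (t + 3))"
    using divide_right_mono[OF card_triples_ge[of l], of "real CARD('a) ^ (t + 3)"] by simp
  also have "\<dots> = (\<Sum>K\<in>?T'. ?v K - ?c K)" using eq by simp
  also have "\<dots> \<le> (\<Sum>K\<in>?T. ?v K - ?c K)"
    using nonneg by (intro sum_mono2) auto
  also have "\<dots> = (\<Sum>K\<in>?T. ?v K) - (\<Sum>K\<in>?T. ?c K)" by (rule sum_subtractf)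
  also have "(\<Sum>K\<in>?T. ?v K) = real num * ((side - 0) * (hi - lo))" by (simp only: volume_eq)
  also have "(\<Sum>K\<in>?T. ?c K) = real (card {n. n < num \<and> (vdc CARD('a) n, eval_at_p (lf_frac (theta * digit_poly_fls n))) \<in> {0..<side} \<times> {lo..<hi}})"
    unfolding card_points_in_box of_nat_sum by (intro sum.cong) auto
  finally show ?thesis .
qed

text \<open>Needed to obtain arbitrarily large numbers of points as \<open>l\<close> grows.\<close>

lemma num_ge: "l \<le> num"
proof -
  have "side > 0" unfolding side_eq using l_pos CARD_gt_1 by (intro sum_pos) auto
  then have "dval CARD('a) \<kappa> h \<noteq> 0" unfolding side_def by (metis div_0 less_irrefl of_nat_0)
  then have num: "CARD('a) ^ (m - h) \<le> num" by (simp add: num_def)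
  have "1 * l \<le> stride * l" using stride_pos by (intro mult_right_mono) auto
  then have l: "l \<le> m - h" unfolding m_eq by linarith
  have "l < 2 ^ l" by (rule less_exp)
  also have "(2::nat) ^ l \<le> CARD('a) ^ l" using CARD_gt_1 by (intro power_mono) auto
  also have "CARD('a) ^ l \<le> CARD('a) ^ (m - h)" using CARD_gt_1 l by (intro power_increasing) auto
  also note num
  finally show ?thesis by simp
qed

lemma discrepancy_ge:
  "real l ^ 2 / 2 / real CARD('a) ^ (t + 3) \<le> real num * discrepancy2 num
    (\<lambda>n. (vdc CARD('a) n, eval_at_p (lf_frac (theta * digit_poly_fls n))))"
proof -
  have p0: "real CARD('a) > 0" using CARD_gt_1 by simp
  have dval_le_1: "real (dval CARD('a) d a) / real CARD('a) ^ a \<le> 1" if "\<And>r. d r < CARD('a)" for d a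
  proof -
    have "dval CARD('a) d a < CARD('a) ^ a" using that by (intro dval_less_power) auto
    then have "real (dval CARD('a) d a) \<le> real (CARD('a) ^ a)" by (intro of_nat_mono) simp
    then show ?thesis using p0 by simp
  qed
  have "0 \<le> hi - lo" unfolding hi_minus_lo by (intro sum_nonneg) auto
  then have "\<bar>real (card {n. n < num \<and> (vdc CARD('a) n, eval_at_p (lf_frac (theta * digit_poly_fls n))) \<in> {0..<side} \<times> {lo..<hi}})
      - real num * ((side - 0) * (hi - lo))\<bar> \<le> real num * discrepancy2 num
    (\<lambda>n. (vdc CARD('a) n, eval_at_p (lf_frac (theta * digit_poly_fls n))))"
    using num_ge l_pos dval_le_1[of \<kappa> h] dval_le_1[of "\<lambda>r. fp_rep (fdig x r)" "h + h"]
      \<kappa>_less fp_rep(1)[OF prime_CARD]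
    by (intro discrepancy2_ge) (auto simp: side_def hi_def lo_def)
  then show ?thesis using deficit by linarith
qed

end

section \<open>Squared logarithmic growth\<close>

context badly_approximable
begin

lemma ex_large_discrepancy:
  assumes "l > 0"
  shows "\<exists>N. l \<le> N \<and> N \<le> CARD('a) ^ height l \<and>
    real l ^ 2 / 2 / real CARD('a) ^ (t + 3) \<le> real N * discrepancy2 N
      (\<lambda>n. (vdc CARD('a) n, eval_at_p (lf_frac (theta * digit_poly_fls n))))"
proof -
  obtain x where x: "x < CARD('a) ^ height l" 
    "\<forall>i<stride * l. dig x i = (of_nat (comb stride i) :: 'a)"
    "\<forall>i<stride * l. dig x (height l - 1 - i) = (of_nat (comb stride i) :: 'a)"
    "\<forall>i<stride * l. fdig x (stride * l + i) = of_nat (comb stride i)"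
    using ex_reference_point[of l] by blast
  interpret reference_point theta t l x
    by unfold_locales (use x assms in auto)
  show ?thesis using num_ge num_le discrepancy_ge by blast
qed

lemma frequently_discrepancy_ge:
  "\<exists>c>0. \<exists>\<^sub>F N in sequentially. c * (ln (real N))\<^sup>2 \<le> real N * discrepancy2 N
     (\<lambda>n. (vdc CARD('a) n, eval_at_p (lf_frac (theta * digit_poly_fls n))))"
proof -
  let ?p = "real CARD('a)"
  let ?D = "\<lambda>N. real N * discrepancy2 N
     (\<lambda>n. (vdc CARD('a) n, eval_at_p (lf_frac (theta * digit_poly_fls n))))"
  \<comment> \<open>\<open>b\<close> comes from
    \<open>ln N \<le> height l * ln p \<le> b * l\<close> with \<open>p = CARD('a)\<close>, and
    \<open>c\<close> is chosen so that \<open>c * (b * l)^2\<close> equals the lower bound on the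
    deficit.\<close>
  define b where "b = 4 * real stride * ln ?p"
  define c where "c = 1 / (2 * ?p ^ (t + 3) * b\<^sup>2)"
  have p: "?p > 1" using CARD_gt_1 by simp
  have b: "b > 0" using p stride_pos by (simp add: b_def)
  have c: "c > 0" using b p by (simp add: c_def)
  have "\<exists>N\<ge>n0. c * (ln (real N))\<^sup>2 \<le> ?D N" for n0
  proof -
    define l where "l = Suc n0"
    have l: "l > 0" "n0 \<le> l" by (auto simp: l_def)
    obtain N where N: "l \<le> N" "N \<le> CARD('a) ^ height l" "real l ^ 2 / 2 / ?p ^ (t + 3) \<le> ?D N"
      using ex_large_discrepancy[OF l(1)] by blast
    have "ln (real N) \<le> ln (?p ^ height l)"
      using N l p by (subst ln_le_cancel_iff) (auto simp flip: of_nat_power)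
    also have "\<dots> = real (height l) * ln ?p" using p by (simp add: ln_realpow)
    also have "\<dots> \<le> (4 * real stride * real l) * ln ?p"
    proof (intro mult_right_mono)
      have "stride * 1 \<le> stride * l" using l by (intro mult_left_mono) auto
      moreover have "t \<le> stride * 1" by (simp add: stride_def)
      ultimately have "height l \<le> 4 * (stride * l)" unfolding height_def by linarith
      then have "real (height l) \<le> real (4 * (stride * l))" by (rule of_nat_mono)
      then show "real (height l) \<le> 4 * real stride * real l" by simp
    qed (use p in auto)
    finally have "ln (real N) \<le> b * real l" by (simp add: b_def algebra_simps)
    moreover have "0 \<le> ln (real N)" using N l by simp
    ultimately have "(ln (real N))\<^sup>2 \<le> (b * real l)\<^sup>2" by (intro power_mono)
    then have "c * (ln (real N))\<^sup>2 \<le> c * (b * real l)\<^sup>2" using c by (intro mult_left_mono) auto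
    also have "\<dots> = real l ^ 2 / 2 / ?p ^ (t + 3)"
      using b p by (simp add: c_def power_mult_distrib)
    also note N(3)
    finally show ?thesis using N l by (intro exI[of _ N]) auto
  qed
  then show ?thesis using c unfolding frequently_sequentially by blast
qed

end

theorem theorem8:
  fixes p :: nat and theta :: "'a::{field,finite} fls"
  assumes "prime p" and "CARD('a) = p"
    and "\<exists>c>0. \<forall>(r::nat) (Q::'a poly). Q \<noteq> 0 \<longrightarrow>
           c \<le> lf_abs (poly_fls Q) * lf_dist (fls_X_inv ^ r * poly_fls Q * theta)"
  shows "\<exists>c'>0. \<exists>\<^sub>F N in sequentially.
           c' * (ln (real N))\<^sup>2 \<le> real N * discrepancy2 N
             (\<lambda>n. (vdc p n, eval_at_p (lf_frac (theta * digit_poly_fls n))))"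
proof -
  obtain C where C: "C > 0" "\<And>r Q. Q \<noteq> 0 \<Longrightarrow>
      C \<le> lf_abs (poly_fls Q) * lf_dist (fls_X_inv ^ r * poly_fls Q * theta)"
    using assms(3) by blast
  have "prime (CARD('a))" using assms(1,2) by simp
  then obtain t where "badly_approximable theta t"
    using badly_approximable_if_counterexample[OF _ C] by blast
  then show ?thesis using badly_approximable.frequently_discrepancy_ge assms(2) by blast
qed

end
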